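(* Let $\nabla$ be a symplectic self-duality on a finite abelian group $L$. If $G$ is a maximal isotropic subgroup of $L$ isomorphic to $(\mathbf Z/p^k\mathbf Z)^l$ for some positive integers $k,l$ and some odd prime $p$, then $(L,\nabla,G)$ is a standard triple.
   Context: $\mathbf T=\mathbf R/\mathbf Z$; $\hat L=\mathrm{Hom}(L,\mathbf T)$. A symplectic self-duality of $L$ is an isomorphism $\nabla:L\to\hat L$ with $\nabla(x)(x)=0$ for all $x$. A subgroup $N$ is isotropic if $\nabla(x)(y)=0$ for $x,y\in N$; maximal isotropic means maximal among isotropic subgroups. For a locally compact abelian (LCA) group $A$ and closed $B\subset A$, $B^\perp=\{\chi\in\hat A:\chi|_B=0\}$ and $\nabla^0(x,\chi)(y,\lambda)=\chi(y)-\lambda(x)$ on $A\times\hat A$. A triple $(L,\nabla,M)$, $M$ maximal isotropic, is standard if there exist an LCA group $A$, a closed subgroup $B\subset A$ and an isomorphism $\phi:A\times\hat A\to L$ with $\nabla(\phi(u))(\phi(v))=\nabla^0(u)(v)$ for all $u,v$ and $\phi(B\times B^\perp)=M$. *)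

theory Defs
  imports "HOL-Algebra.Algebra"
begin

definition int_diff_rel :: "real \<Rightarrow> real \<Rightarrow> bool" where
  "int_diff_rel x y \<longleftrightarrow> x - y \<in> \<int>"

quotient_type circ = real / int_diff_rel
  unfolding equivp_def int_diff_rel_def
proof (intro allI)
  fix x y :: real
  show "(x - y \<in> \<int>) = ((\<lambda>z. x - z \<in> \<int>) = (\<lambda>z. y - z \<in> \<int>))"
  proof
    assume h: "x - y \<in> \<int>"
    show "(\<lambda>z. x - z \<in> \<int>) = (\<lambda>z. y - z \<in> \<int>)"
    proof
      fix z
      have "y - z = (x - z) - (x - y)" by simp
      moreover have "x - z = (y - z) + (x - y)" by simp
      ultimately show "(x - z \<in> \<int>) = (y - z \<in> \<int>)"
        using h Ints_add Ints_diff by (metis)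
    qed
  next
    assume "(\<lambda>z. x - z \<in> \<int>) = (\<lambda>z. y - z \<in> \<int>)"
    then have "(x - y \<in> \<int>) = (y - y \<in> \<int>)" by metis
    then show "x - y \<in> \<int>" by simp
  qed
qed

instantiation circ :: ab_group_add
begin

lift_definition zero_circ :: circ is "0::real" .

lift_definition plus_circ :: "circ \<Rightarrow> circ \<Rightarrow> circ" is "(+)"
  unfolding int_diff_rel_def
proof -
  fix a b c d :: real
  assume "a - b \<in> \<int>" "c - d \<in> \<int>"
  then have "(a - b) + (c - d) \<in> \<int>" by (rule Ints_add)
  moreover have "(a - b) + (c - d) = a + c - (b + d)" by simp
  ultimately show "a + c - (b + d) \<in> \<int>" by simp
qed

lift_definition uminus_circ :: "circ \<Rightarrow> circ" is uminus
  unfolding int_diff_rel_def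
proof -
  fix a b :: real
  assume "a - b \<in> \<int>"
  then have "- (a - b) \<in> \<int>" by (rule Ints_minus)
  moreover have "- (a - b) = - a - - b" by simp
  ultimately show "- a - - b \<in> \<int>" by simp
qed

lift_definition minus_circ :: "circ \<Rightarrow> circ \<Rightarrow> circ" is "(-)"
  unfolding int_diff_rel_def
proof -
  fix a b c d :: real
  assume "a - b \<in> \<int>" "c - d \<in> \<int>"
  then have "(a - b) - (c - d) \<in> \<int>" by (rule Ints_diff)
  moreover have "(a - b) - (c - d) = (a - c) - (b - d)" by simp
  ultimately show "a - c - (b - d) \<in> \<int>" by simp
qed

instance
proof
  fix a b c :: circ
  show "a + b + c = a + (b + c)" by transfer (simp add: int_diff_rel_def)
  show "a + b = b + a" by transfer (simp add: int_diff_rel_def)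
  show "0 + a = a" by transfer (simp add: int_diff_rel_def)
  show "- a + a = 0" by transfer (simp add: int_diff_rel_def)
  show "a - b = a + - b" by transfer (simp add: int_diff_rel_def)
qed

end

definition circle_group :: "circ monoid" where
  "circle_group = \<lparr>carrier = UNIV, monoid.mult = (+), one = 0\<rparr>"

definition dual :: "('a, 'b) monoid_scheme \<Rightarrow> ('a \<Rightarrow> circ) monoid" where
  "dual A = \<lparr>carrier = {\<chi>. \<chi> \<in> hom A circle_group \<and> \<chi> \<in> extensional (carrier A)},
             monoid.mult = (\<lambda>\<chi> \<psi>. \<lambda>x\<in>carrier A. \<chi> x + \<psi> x),
             one = (\<lambda>x\<in>carrier A. 0)\<rparr>"

definition symplectic_self_duality :: "('a, 'b) monoid_scheme \<Rightarrow> ('a \<Rightarrow> 'a \<Rightarrow> circ) \<Rightarrow> bool" where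
  "symplectic_self_duality L nabla \<longleftrightarrow>
     nabla \<in> iso L (dual L) \<and> (\<forall>x\<in>carrier L. nabla x x = 0)"

definition isotropic :: "('a, 'b) monoid_scheme \<Rightarrow> ('a \<Rightarrow> 'a \<Rightarrow> circ) \<Rightarrow> 'a set \<Rightarrow> bool" where
  "isotropic L nabla N \<longleftrightarrow> subgroup N L \<and> (\<forall>x\<in>N. \<forall>y\<in>N. nabla x y = 0)"

definition maximal_isotropic :: "('a, 'b) monoid_scheme \<Rightarrow> ('a \<Rightarrow> 'a \<Rightarrow> circ) \<Rightarrow> 'a set \<Rightarrow> bool" where
  "maximal_isotropic L nabla M \<longleftrightarrow>
     isotropic L nabla M \<and> (\<forall>N. isotropic L nabla N \<and> M \<subseteq> N \<longrightarrow> N = M)"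

definition annihilator :: "('a, 'b) monoid_scheme \<Rightarrow> 'a set \<Rightarrow> ('a \<Rightarrow> circ) set" where
  "annihilator A B = {\<chi> \<in> carrier (dual A). \<forall>b\<in>B. \<chi> b = 0}"

definition nabla0 :: "'a \<times> ('a \<Rightarrow> circ) \<Rightarrow> 'a \<times> ('a \<Rightarrow> circ) \<Rightarrow> circ" where
  "nabla0 u v = snd u (fst v) - snd v (fst u)"

text \<open>Standard triple. Since L is finite, any A with A x dual(A) isomorphic to L is finite,
  hence discrete; we take A to be a finite abelian group (discrete topology, every subgroup
  closed), with elements represented by natural numbers.\<close>
definition standard_triple :: "('a, 'b) monoid_scheme \<Rightarrow> ('a \<Rightarrow> 'a \<Rightarrow> circ) \<Rightarrow> 'a set \<Rightarrow> bool" where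
  "standard_triple L nabla M \<longleftrightarrow>
     (\<exists>(A :: nat monoid) B phi.
        comm_group A \<and> finite (carrier A) \<and> subgroup B A \<and>
        phi \<in> iso (A \<times>\<times> dual A) L \<and>
        (\<forall>u\<in>carrier (A \<times>\<times> dual A). \<forall>v\<in>carrier (A \<times>\<times> dual A).
            nabla (phi u) (phi v) = nabla0 u v) \<and>
        phi ` (B \<times> annihilator A B) = M)"

end

theory Submission
  imports Defs "HOL-Library.Function_Algebras"
begin

text \<open>
  It suffices to write L as the sum of two isotropic subgroups C and D such that G is the sum of its
  intersections with C and D: then D is dual to C, and G corresponds to B together with its
  annihilator for B the intersection of G and C.

  Such a decomposition is built by splitting off orthogonal blocks. Since G is its own orthogonal
  complement, p^k maps L into G, so p^k nabla(x)(y) is an alternating form on L with values of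
  p-power order. If it vanishes, L has exponent p^k, and some x in L and g in G with nabla(x)(g) of
  order p^k span a hyperbolic plane. Otherwise choose x and y for which its value has maximal order
  p^e. As G is homogeneous, p^k x = p^(k-e) u and p^k y = p^(k-e) v with u and v in G, which can be
  adjusted such that u is orthogonal to x and v is orthogonal to y. Then x, y, u, v generate an
  orthogonal summand of L, which is the sum of the isotropic subgroups (x, u) and (y, v).
\<close>

section \<open>Abelian groups as modules over the integers\<close>

text \<open>The compatibility with G decides which blocks can be used. The roots u and v are taken
  because pairings with G are killed by p^k while w(u,y) and w(v,x) have order exactly p^k; as the
  p^k-torsion of the circle is cyclic, every pairing with u or v is then a multiple of w(y,u) or
  w(x,v). The values of w on x and y can have larger order, but for z orthogonal to u and v one has
  p^k w(z,x) = p^(k-e) w(z,u) = 0, and likewise for y. So an element is projected to the block in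
  two rounds, first by multiples of x and y, then by multiples of u and v. An element of G is
  orthogonal to u and v from the start and meets only the second round, whose corrections lie in G.
  Maximality of e makes p^e kill p^k x, by nondegeneracy, and only then does homogeneity provide the
  root u. The adjustment of u rests on alternation: p^(k-e) kills w(u,x), so w(u,x) is cancelled by
  a multiple of v that p^(k-e) kills as well, and the difference is still a root.\<close>

definition zmul :: "int \<Rightarrow> 'a::ab_group_add \<Rightarrow> 'a" where
  "zmul n x = (((+) x) ^^ nat n) 0 - (((+) x) ^^ nat (- n)) 0"

lemma funpow_plus_add:
  fixes x :: "'a::ab_group_add"
  shows "(((+) x) ^^ (m + n)) 0 = (((+) x) ^^ m) 0 + (((+) x) ^^ n) 0"
  by (induction m) (simp_all add: add.assoc)

text \<open>Every integer is a difference of naturals in many ways; independence of the choice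
  reduces additivity in the scalar to adding iteration counts, without a case split on
  signs.\<close>

lemma zmul_int_diff:
  "zmul (int a - int b) x = (((+) x) ^^ a) 0 - (((+) x) ^^ b) (0::'a::ab_group_add)"
proof (cases "b \<le> a")
  case True
  then obtain d where "a = b + d"
    using le_Suc_ex by blast
  then show ?thesis
    by (simp add: zmul_def funpow_plus_add)
next
  case False
  then obtain d where "b = a + d"
    using le_Suc_ex nat_le_linear by blast
  then show ?thesis
    by (simp add: zmul_def funpow_plus_add)
qed

lemma zmul_add: "zmul (m + n) x = zmul m x + zmul n x"
proof -
  obtain a b where m: "m = int a - int b"
    using int_diff_cases by blast
  obtain c d where n: "n = int c - int d"
    using int_diff_cases by blast
  have "m + n = int (a + c) - int (b + d)"
    using m n by simp
  then show ?thesis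
    unfolding m n by (simp only: zmul_int_diff funpow_plus_add) simp
qed

lemma zmul_zero: "zmul 0 x = 0"
  by (simp add: zmul_def)

lemma zmul_one: "zmul 1 x = x"
  by (simp add: zmul_def)

lemma zmul_minus: "zmul (- n) x = - zmul n x"
  by (simp add: zmul_def)

text \<open>Additivity is asked only on S because the forms below are controlled only on a subgroup
  V of the ambient type.\<close>

lemma additive_zmul:
  fixes f :: "'a::ab_group_add \<Rightarrow> 'b::ab_group_add"
  assumes add: "\<And>x y. x \<in> S \<Longrightarrow> y \<in> S \<Longrightarrow> f (x + y) = f x + f y"
    and S: "0 \<in> S" "\<And>x y. x \<in> S \<Longrightarrow> y \<in> S \<Longrightarrow> x + y \<in> S" "\<And>x. x \<in> S \<Longrightarrow> - x \<in> S"
    and x: "x \<in> S"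
  shows "zmul n x \<in> S \<and> f (zmul n x) = zmul n (f x)"
proof -
  have f0: "f 0 = 0"
    using add[of 0 0] S(1) by simp
  have nat: "zmul (int m) x \<in> S \<and> f (zmul (int m) x) = zmul (int m) (f x)" for m
  proof (induction m)
    case 0
    then show ?case
      using f0 S(1) by (simp add: zmul_zero)
  next
    case (Suc m)
    have "zmul (int (Suc m)) x = x + zmul (int m) x" "zmul (int (Suc m)) (f x) = f x + zmul (int m) (f x)"
      by (simp_all add: zmul_add zmul_one)
    then show ?case
      using Suc add x S by simp
  qed
  have fm: "f (- y) = - f y" if "y \<in> S" for y
    using add[of y "- y"] f0 that S(3) by (simp add: eq_neg_iff_add_eq_0 add.commute)
  show ?thesis
  proof (cases "n \<ge> 0")
    case True
    then show ?thesis
      using nat[of "nat n"] by simp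
  next
    case False
    then have n: "n = - int (nat (- n))"
      by simp
    show ?thesis
      using nat[of "nat (- n)"] S(3) fm by (subst (1 2 3) n) (simp add: zmul_minus del: int_nat_eq)
  qed
qed

lemma zmul_ring: "zmul n r = of_int n * (r :: 'a::ring_1)"
proof -
  have "zmul n (1::int) = n"
  proof -
    have "(((+) (1::int)) ^^ a) 0 = int a" for a
      by (induction a) simp_all
    then show ?thesis
      by (simp add: zmul_def)
  qed
  then show ?thesis
    using additive_zmul[of UNIV "\<lambda>k. of_int k * r" 1 n] by (simp add: distrib_right)
qed

text \<open>Over the integers, subspaces are subgroups and spans are generated subgroups, so linear
  algebra applies to abelian groups.\<close>

interpretation Z: Modules.module "zmul :: int \<Rightarrow> 'a \<Rightarrow> 'a::ab_group_add"
proof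
  fix m n :: int and x y :: 'a
  show "zmul m (x + y) = zmul m x + zmul m y"
  proof -
    have "(((+) (x + y)) ^^ a) 0 = (((+) x) ^^ a) 0 + (((+) y) ^^ a) 0" for a
      by (induction a) (simp_all add: algebra_simps)
    then show ?thesis
      by (simp add: zmul_def)
  qed
  show "zmul (m + n) x = zmul m x + zmul n x"
    by (rule zmul_add)
  show "zmul 1 x = x"
    by (rule zmul_one)
  show "zmul m (zmul n x) = zmul (m * n) x"
    using additive_zmul[of UNIV "\<lambda>k. zmul k x" n m] by (simp add: zmul_add zmul_ring)
qed

lemma subspace_sums:
  assumes "Z.subspace S" "Z.subspace T"
  shows "Z.subspace {x + y | x y. x \<in> S \<and> y \<in> T}"
proof -
  have spans: "Z.span S = S" "Z.span T = T"
    using assms by simp_all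
  show ?thesis
    using Z.subspace_span[of "S \<union> T"] unfolding Z.span_Un spans .
qed

lemma subspace_of_add_closed:
  assumes "0 \<in> S" "\<And>x y. x \<in> S \<Longrightarrow> y \<in> S \<Longrightarrow> x + y \<in> S" "\<And>x. x \<in> S \<Longrightarrow> - x \<in> S"
  shows "Z.subspace S"
  using assms additive_zmul[of S "\<lambda>x. x"] by (intro Z.subspaceI) auto

section \<open>Elements of prime power order in the circle\<close>

lemma abs_circ_eq_0_iff: "abs_circ r = 0 \<longleftrightarrow> r \<in> \<int>"
  by (simp add: zero_circ_def circ.abs_eq_iff int_diff_rel_def)

lemma zmul_abs_circ: "zmul n (abs_circ r) = abs_circ (of_int n * r)"
  using additive_zmul[of UNIV abs_circ r n] by (simp add: plus_circ.abs_eq zmul_ring)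

text \<open>For prime p this is order exactly p^k, since every proper divisor of p^k divides
  p^(k-1). At k = 0 the truncated \<open>k - 1\<close> would make the last two conditions contradict
  each other.\<close>

definition has_order_pow :: "int \<Rightarrow> nat \<Rightarrow> circ \<Rightarrow> bool" where
  "has_order_pow p k t \<longleftrightarrow> k > 0 \<and> zmul (p ^ k) t = 0 \<and> zmul (p ^ (k - 1)) t \<noteq> 0"

text \<open>Being killed by p^k makes t the class of some a / p^k; a factor p of a would cancel, and
  p^(k-1) would already kill t.\<close>

lemma has_order_pow_coprime:
  assumes "Factorial_Ring.prime p" "has_order_pow p k t"
  obtains r a where "t = abs_circ r" "of_int (p ^ k) * r = of_int a" "coprime (p ^ k) a"
proof -
  obtain r where r: "t = abs_circ r"
    by (metis Quotient_abs_rep Quotient_circ)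
  have "of_int (p ^ k) * r \<in> \<int>"
    using assms(2) unfolding has_order_pow_def r zmul_abs_circ abs_circ_eq_0_iff by blast
  then obtain a where a: "of_int (p ^ k) * r = of_int a"
    by (auto elim: Ints_cases)
  have "\<not> p dvd a"
  proof
    assume "p dvd a"
    then obtain b where b: "a = p * b" ..
    have "p ^ k = p * p ^ (k - 1)"
      using assms(2) by (simp add: has_order_pow_def power_eq_if)
    then have "of_int p * (of_int (p ^ (k - 1)) * r) = of_int p * (of_int b :: real)"
      using a b by (simp add: mult.assoc)
    then have "of_int (p ^ (k - 1)) * r = of_int b"
      using assms(1) by (simp del: of_int_power)
    then have "zmul (p ^ (k - 1)) t = 0"
      unfolding r zmul_abs_circ abs_circ_eq_0_iff by (metis Ints_of_int)
    then show False
      using assms(2) by (simp add: has_order_pow_def)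
  qed
  then have "coprime (p ^ k) a"
    using assms(1) by (simp add: prime_imp_coprime)
  with r a that show thesis by blast
qed

lemma has_order_pow_dvd:
  assumes "Factorial_Ring.prime p" "has_order_pow p k t" "zmul n t = 0"
  shows "p ^ k dvd n"
proof -
  obtain r a where r: "t = abs_circ r" "of_int (p ^ k) * r = of_int a" "coprime (p ^ k) a"
    using has_order_pow_coprime assms by metis
  have "of_int n * r \<in> \<int>"
    using assms(3) unfolding r zmul_abs_circ abs_circ_eq_0_iff .
  then obtain b where "of_int n * r = of_int b"
    by (auto elim: Ints_cases)
  then have "of_int (n * a) = (of_int (p ^ k * b) :: real)"
    using r(2) by (metis mult.left_commute of_int_mult)
  then have "n * a = p ^ k * b"
    by linarith
  then show ?thesis
    using r(3) by (metis coprime_dvd_mult_left_iff dvd_triv_left)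
qed

text \<open>The p^k-torsion of the circle is cyclic, so any of its elements of full order generates
  it. This supplies all coefficients in the eliminations below.\<close>

lemma has_order_pow_generates:
  assumes "Factorial_Ring.prime p" "has_order_pow p k t" "zmul (p ^ k) s = 0"
  obtains c where "s = zmul c t"
proof -
  obtain r a where r: "t = abs_circ r" "of_int (p ^ k) * r = of_int a" "coprime (p ^ k) a"
    using has_order_pow_coprime assms by metis
  obtain q where q: "s = abs_circ q"
    by (metis Quotient_abs_rep Quotient_circ)
  have "of_int (p ^ k) * q \<in> \<int>"
    using assms(3) unfolding q zmul_abs_circ abs_circ_eq_0_iff .
  then obtain b where b: "of_int (p ^ k) * q = of_int b"
    by (auto elim: Ints_cases)
  \<comment> \<open>Since s is the class of b / p^k and v inverts a modulo p^k, the coefficient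
    sought is \<open>b * v\<close>.\<close>
  obtain u v where uv: "u * p ^ k + v * a = 1"
    using r(3) by (metis bezout_int coprime_imp_gcd_eq_1)
  have "of_int (p ^ k) * (of_int (b * v) * r - q) = of_int (p ^ k) * (- of_int (b * u) :: real)"
  proof -
    have "of_int (p ^ k) * (of_int (b * v) * r - q) = of_int (b * v) * (of_int (p ^ k) * r) - of_int (p ^ k) * q"
      by (simp add: algebra_simps)
    also have "\<dots> = of_int (b * (v * a) - b)"
      unfolding r(2) b by simp
    also have "b * (v * a) - b = p ^ k * (- (b * u))"
    proof -
      have "v * a = 1 - u * p ^ k"
        using uv by simp
      then show ?thesis
        by (simp only:) (simp add: algebra_simps)
    qed
    finally show ?thesis
      by simp
  qed
  then have "of_int (b * v) * r - q = - of_int (b * u)"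
    using assms(1) by (subst (asm) mult_left_cancel) auto
  then have "of_int (b * v) * r - q \<in> \<int>"
    by simp
  then have "s = zmul (b * v) t"
    unfolding r q zmul_abs_circ using circ.abs_eq_iff int_diff_rel_def by metis
  then show thesis
    by (rule that)
qed


lemma has_order_pow_minus: "has_order_pow p k (- t) \<longleftrightarrow> has_order_pow p k t"
  by (simp add: has_order_pow_def)

section \<open>Alternating forms with values in the circle\<close>

text \<open>The explicit V allows for the form used later, whose second argument is read through a
  preimage under \<open>embed\<close> and is meaningful only on the image of L.\<close>

locale alternating_form =
  fixes V :: "'v::ab_group_add set" and w :: "'v \<Rightarrow> 'v \<Rightarrow> circ"
  assumes subspace_V: "Z.subspace V"
    and add_left: "\<lbrakk>x \<in> V; y \<in> V; z \<in> V\<rbrakk> \<Longrightarrow> w (x + y) z = w x z + w y z"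
    and alternating: "x \<in> V \<Longrightarrow> w x x = 0"
    and add_right: "\<lbrakk>x \<in> V; y \<in> V; z \<in> V\<rbrakk> \<Longrightarrow> w z (x + y) = w z x + w z y"
begin

lemma V_closed:
  "0 \<in> V" "\<lbrakk>x \<in> V; y \<in> V\<rbrakk> \<Longrightarrow> x + y \<in> V" "\<lbrakk>x \<in> V; y \<in> V\<rbrakk> \<Longrightarrow> x - y \<in> V"
  "x \<in> V \<Longrightarrow> - x \<in> V" "x \<in> V \<Longrightarrow> zmul n x \<in> V"
  using subspace_V
  by (auto intro: Z.subspace_0 Z.subspace_add Z.subspace_diff Z.subspace_neg Z.subspace_scale)

lemma skew:
  assumes "x \<in> V" "y \<in> V"
  shows "w y x = - w x y"
proof -
  have "w (x + y) (x + y) = w x y + w y x"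
    using assms alternating[of x] alternating[of y] by (simp add: add_left add_right V_closed)
  moreover have "w (x + y) (x + y) = 0"
    using assms by (intro alternating V_closed)
  ultimately show ?thesis
    by (simp add: eq_neg_iff_add_eq_0 add.commute)
qed

lemma zmul_left: "\<lbrakk>x \<in> V; y \<in> V\<rbrakk> \<Longrightarrow> w (zmul n x) y = zmul n (w x y)"
  using additive_zmul[of V "\<lambda>x. w x y" x n] add_left V_closed by blast

lemma zmul_right: "\<lbrakk>x \<in> V; y \<in> V\<rbrakk> \<Longrightarrow> w y (zmul n x) = zmul n (w y x)"
  using additive_zmul[of V "w y" x n] add_right V_closed by blast

lemma zero_left: "x \<in> V \<Longrightarrow> w 0 x = 0"
  using zmul_left[of 0 x 0] V_closed(1) by simp

lemma zero_right: "x \<in> V \<Longrightarrow> w x 0 = 0"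
  using zmul_right[of 0 x 0] V_closed(1) by simp

lemma diff_left: "\<lbrakk>x \<in> V; y \<in> V; z \<in> V\<rbrakk> \<Longrightarrow> w (x - y) z = w x z - w y z"
  using add_left[of "x - y" y z] V_closed by simp

lemma diff_right: "\<lbrakk>x \<in> V; y \<in> V; z \<in> V\<rbrakk> \<Longrightarrow> w z (x - y) = w z x - w z y"
  using add_right[of "x - y" y z] V_closed by simp

lemmas form_simps = add_left add_right zmul_left zmul_right zero_left zero_right
  diff_left diff_right alternating V_closed

definition null :: "'v set \<Rightarrow> bool" where
  "null N \<longleftrightarrow> (\<forall>x\<in>N. \<forall>y\<in>N. w x y = 0)"

lemma orthogonal_span:
  assumes "S \<subseteq> V" "u \<in> V" "\<And>s. s \<in> S \<Longrightarrow> w u s = 0" "n \<in> Z.span S"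
  shows "w u n = 0"
proof -
  have "Z.subspace {v \<in> V. w u v = 0}"
    using assms(2) by (auto simp: Z.subspace_def form_simps)
  then have "Z.span S \<subseteq> {v \<in> V. w u v = 0}"
    using assms by (intro Z.span_minimal) auto
  then show ?thesis
    using assms(4) by blast
qed

lemma null_span:
  assumes "S \<subseteq> V" "null S"
  shows "null (Z.span S)"
proof -
  have V: "Z.span S \<subseteq> V"
    using assms(1) subspace_V by (rule Z.span_minimal)
  have "w u s = 0" if "u \<in> Z.span S" "s \<in> S" for u s
    using orthogonal_span[of S s u] that assms V skew[of s u] unfolding null_def by auto
  then show ?thesis
    using orthogonal_span[of S] assms(1) V unfolding null_def by blast
qed

text \<open>The last two conditions make G a direct sum of copies of Z/p^k, in a form that direct
  summands inherit without choosing a basis.\<close>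

definition homogeneous_lagrangian :: "int \<Rightarrow> nat \<Rightarrow> 'v set \<Rightarrow> 'v set \<Rightarrow> bool" where
  "homogeneous_lagrangian p k K G \<longleftrightarrow>
     Z.subspace K \<and> K \<subseteq> V \<and> Z.subspace G \<and> G \<subseteq> K \<and> null G \<and>
     (\<forall>x\<in>K. (\<forall>y\<in>K. w x y = 0) \<longrightarrow> x = 0) \<and>
     (\<forall>x\<in>K. (\<forall>g\<in>G. w x g = 0) \<longrightarrow> x \<in> G) \<and>
     (\<forall>g\<in>G. zmul (p ^ k) g = 0) \<and>
     (\<forall>e\<le>k. \<forall>g\<in>G. zmul (p ^ e) g = 0 \<longrightarrow> (\<exists>h\<in>G. g = zmul (p ^ (k - e)) h))"

text \<open>Orthogonal summands are expressed through the existence of projections. If K is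
  nondegenerate, the sum of A and B meets its orthogonal complement in 0, because a common element
  is orthogonal to all of K. The clause on G says that the projection of G stays in G, component by
  component.\<close>

definition orthogonal_block :: "'v set \<Rightarrow> 'v set \<Rightarrow> 'v set \<Rightarrow> 'v set \<Rightarrow> bool" where
  "orthogonal_block K G A B \<longleftrightarrow>
     Z.subspace A \<and> Z.subspace B \<and> A \<subseteq> K \<and> B \<subseteq> K \<and> null A \<and> null B \<and>
     (\<forall>x\<in>K. \<exists>a\<in>A. \<exists>b\<in>B. \<forall>n\<in>A \<union> B. w (x - a - b) n = 0) \<and>
     (\<forall>g\<in>G. \<exists>a\<in>G \<inter> A. \<exists>b\<in>G \<inter> B. \<forall>n\<in>A \<union> B. w (g - a - b) n = 0)"

text \<open>The sum is direct when K is nondegenerate: a common element of A and B pairs to 0 with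
  both, hence with K.\<close>

definition lagrangian_splitting :: "'v set \<Rightarrow> 'v set \<Rightarrow> 'v set \<Rightarrow> 'v set \<Rightarrow> bool" where
  "lagrangian_splitting K G A B \<longleftrightarrow>
     Z.subspace A \<and> Z.subspace B \<and> A \<subseteq> K \<and> B \<subseteq> K \<and> null A \<and> null B \<and>
     (\<forall>x\<in>K. \<exists>a\<in>A. \<exists>b\<in>B. x = a + b) \<and>
     (\<forall>g\<in>G. \<exists>a\<in>G \<inter> A. \<exists>b\<in>G \<inter> B. g = a + b)"

lemma orthogonal_block_span:
  assumes K: "Z.subspace K" "K \<subseteq> V" "G \<subseteq> K"
    and ST: "S \<subseteq> K" "T \<subseteq> K" "null S" "null T"
    and proj: "\<And>x. x \<in> K \<Longrightarrow> \<exists>a\<in>Z.span S. \<exists>b\<in>Z.span T. \<forall>n\<in>S \<union> T. w (x - a - b) n = 0"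
      "\<And>g. g \<in> G \<Longrightarrow> \<exists>a\<in>G \<inter> Z.span S. \<exists>b\<in>G \<inter> Z.span T. \<forall>n\<in>S \<union> T. w (g - a - b) n = 0"
  shows "orthogonal_block K G (Z.span S) (Z.span T)"
proof -
  have sub: "Z.span S \<subseteq> K" "Z.span T \<subseteq> K"
    using Z.span_minimal[OF ST(1) K(1)] Z.span_minimal[OF ST(2) K(1)] .
  have V: "S \<subseteq> V" "T \<subseteq> V"
    using K ST by auto
  have null: "null (Z.span S)" "null (Z.span T)"
    using null_span[OF V(1) ST(3)] null_span[OF V(2) ST(4)] .
  have orth: "\<forall>n\<in>Z.span S \<union> Z.span T. w (x - a - b) n = 0"
    if "x \<in> K" "a \<in> Z.span S" "b \<in> Z.span T" "\<forall>n\<in>S \<union> T. w (x - a - b) n = 0" for x a b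
  proof
    fix n assume n: "n \<in> Z.span S \<union> Z.span T"
    have "x - a - b \<in> V"
      using that(1-3) sub K(2) by (intro V_closed) blast+
    then show "w (x - a - b) n = 0"
      using n that(4) orthogonal_span[OF V(1), of "x - a - b" n]
        orthogonal_span[OF V(2), of "x - a - b" n] by blast
  qed
  have "\<exists>a\<in>Z.span S. \<exists>b\<in>Z.span T. \<forall>n\<in>Z.span S \<union> Z.span T. w (x - a - b) n = 0"
    if x: "x \<in> K" for x
  proof -
    obtain a b where "a \<in> Z.span S" "b \<in> Z.span T" "\<forall>n\<in>S \<union> T. w (x - a - b) n = 0"
      using proj(1)[OF x] by (elim bexE) 
    then show ?thesis
      by (intro bexI[of _ a] bexI[of _ b] orth x)
  qed
  moreover have "\<exists>a\<in>G \<inter> Z.span S. \<exists>b\<in>G \<inter> Z.span T. \<forall>n\<in>Z.span S \<union> Z.span T. w (g - a - b) n = 0"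
    if g: "g \<in> G" for g
  proof -
    obtain a b where ab: "a \<in> G \<inter> Z.span S" "b \<in> G \<inter> Z.span T" "\<forall>n\<in>S \<union> T. w (g - a - b) n = 0"
      using proj(2)[OF g] by (elim bexE)
    have "g \<in> K"
      using g K(3) by blast
    from orth[OF this IntD2[OF ab(1)] IntD2[OF ab(2)] ab(3)] show ?thesis
      by (intro bexI[OF _ ab(1)] bexI[OF _ ab(2)])
  qed
  ultimately show ?thesis
    unfolding orthogonal_block_def using sub null Z.subspace_span[of S] Z.subspace_span[of T] by (intro conjI ballI)
qed

section \<open>Orthogonal blocks inside a homogeneous Lagrangian\<close>

context
  fixes p :: int and k :: nat and K G :: "'v set"
  assumes p: "Factorial_Ring.prime p" and k: "k > 0"
    and hl: "homogeneous_lagrangian p k K G"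
begin

lemma lagrangianD:
  shows "Z.subspace K" "K \<subseteq> V" "Z.subspace G" "G \<subseteq> K" "null G"
    and nondegenerate: "\<lbrakk>x \<in> K; \<And>y. y \<in> K \<Longrightarrow> w x y = 0\<rbrakk> \<Longrightarrow> x = 0"
    and self_perp: "\<lbrakk>x \<in> K; \<And>g. g \<in> G \<Longrightarrow> w x g = 0\<rbrakk> \<Longrightarrow> x \<in> G"
    and torsion: "g \<in> G \<Longrightarrow> zmul (p ^ k) g = 0"
    and divisible: "\<lbrakk>e \<le> k; g \<in> G; zmul (p ^ e) g = 0\<rbrakk> \<Longrightarrow> \<exists>h\<in>G. g = zmul (p ^ (k - e)) h"
  using hl unfolding homogeneous_lagrangian_def by blast+

lemma in_V: "x \<in> K \<Longrightarrow> x \<in> V" "g \<in> G \<Longrightarrow> g \<in> V" "g \<in> G \<Longrightarrow> g \<in> K"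
  using lagrangianD by auto

lemma torsion_form:
  assumes "x \<in> K" "g \<in> G"
  shows "zmul (p ^ k) (w x g) = 0" "zmul (p ^ k) (w g x) = 0"
proof -
  show "zmul (p ^ k) (w x g) = 0"
    using zmul_right[of g x "p ^ k"] torsion zero_right assms in_V by simp
  show "zmul (p ^ k) (w g x) = 0"
    using zmul_left[of g x "p ^ k"] torsion zero_left assms in_V by simp
qed

lemma zmul_in_G:
  assumes "x \<in> K"
  shows "zmul (p ^ k) x \<in> G"
proof (rule self_perp)
  show "zmul (p ^ k) x \<in> K"
    using lagrangianD(1) assms by (rule Z.subspace_scale)
  show "w (zmul (p ^ k) x) g = 0" if "g \<in> G" for g
    using that assms in_V torsion_form by (simp add: zmul_left)
qed

lemma exists_partner:
  assumes e: "0 < e" "e \<le> k"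
    and bound: "\<And>x y. x \<in> K \<Longrightarrow> y \<in> K \<Longrightarrow> zmul (p ^ e * p ^ k) (w x y) = 0"
    and xy: "x \<in> K" "y \<in> K" "zmul (p ^ (e - 1) * p ^ k) (w x y) \<noteq> 0"
  obtains u where "u \<in> G" "zmul (p ^ k) x = zmul (p ^ (k - e)) u" "w u x = 0"
    "has_order_pow p k (w u y)"
proof -
  \<comment> \<open>The bound says that p^e p^k x pairs to 0 with all of K, so p^e kills p^k x, and
    divisibility in G applies.\<close>
  have root: "\<exists>u\<in>G. zmul (p ^ k) x = zmul (p ^ (k - e)) u" if "x \<in> K" for x
  proof (rule divisible[OF e(2) zmul_in_G[OF that]])
    show "zmul (p ^ e) (zmul (p ^ k) x) = 0"
    proof (rule nondegenerate)
      show "zmul (p ^ e) (zmul (p ^ k) x) \<in> K"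
        using lagrangianD(1) that by (intro Z.subspace_scale)
      show "w (zmul (p ^ e) (zmul (p ^ k) x)) y = 0" if "y \<in> K" for y
        using bound[OF \<open>x \<in> K\<close> that] that \<open>x \<in> K\<close> in_V by (simp add: form_simps)
    qed
  qed
  \<comment> \<open>The exponents e - 1 and k - e add up to k - 1. The variables are generic because
    the fact serves the pair (y, x) with v as well as the pair (x, y) with the adjusted
    root.\<close>
  have order: "has_order_pow p k (w u y)"
    if "x \<in> K" "y \<in> K" "zmul (p ^ (e - 1) * p ^ k) (w x y) \<noteq> 0"
      "u \<in> G" "zmul (p ^ k) x = zmul (p ^ (k - e)) u" for x y u
  proof -
    have "zmul (p ^ (k - 1)) (w u y) = zmul (p ^ (e - 1)) (zmul (p ^ (k - e)) (w u y))"
      using e by (simp flip: power_add)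
    also have "zmul (p ^ (k - e)) (w u y) = zmul (p ^ k) (w x y)"
      using zmul_left[of u y "p ^ (k - e)"] zmul_left[of x y "p ^ k"] that in_V by simp
    finally show ?thesis
      using that torsion_form k by (simp add: has_order_pow_def)
  qed
  obtain u where u: "u \<in> G" "zmul (p ^ k) x = zmul (p ^ (k - e)) u"
    using root xy by blast
  obtain v where v: "v \<in> G" "zmul (p ^ k) y = zmul (p ^ (k - e)) v"
    using root xy by blast
  have "zmul (p ^ (e - 1) * p ^ k) (w y x) \<noteq> 0"
    using xy skew[of x y] in_V by simp
  then have vx: "has_order_pow p k (w v x)"
    using order[of y x v] xy v by blast
  obtain c where c: "w u x = zmul c (w v x)"
    using has_order_pow_generates[OF p vx torsion_form(2)] xy u by metis
  \<comment> \<open>Alternation enters here: p^(k-e) kills w(u,x) = c w(v,x), hence p^k divides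
    p^(k-e) c, and c v can be subtracted from u without changing p^(k-e) u.\<close>
  have "zmul (p ^ (k - e)) (w u x) = w (zmul (p ^ k) x) x"
    unfolding u(2) using u xy in_V by (simp add: form_simps)
  also have "\<dots> = 0"
    using xy in_V by (simp add: form_simps)
  finally have "zmul (p ^ (k - e) * c) (w v x) = 0"
    by (simp add: c)
  then have "p ^ k dvd p ^ (k - e) * c"
    by (rule has_order_pow_dvd[OF p vx])
  then obtain d where "p ^ (k - e) * c = d * p ^ k"
    by (metis dvdE mult.commute)
  then have cv: "zmul (p ^ (k - e)) (zmul c v) = 0"
    using torsion[OF v(1)] by (metis Z.scale_scale Z.scale_zero_right)
  show thesis
  proof
    show 1: "u - zmul c v \<in> G"
      using u v lagrangianD(3) by (intro Z.subspace_diff Z.subspace_scale)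
    show 2: "zmul (p ^ k) x = zmul (p ^ (k - e)) (u - zmul c v)"
      using u cv by (simp add: Z.scale_right_diff_distrib)
    show "w (u - zmul c v) x = 0"
      using u v xy c in_V by (simp add: form_simps)
    show "has_order_pow p k (w (u - zmul c v) y)"
      using order[OF xy 1 2] .
  qed
qed

text \<open>The partners are crossed: u is a root of p^k x but pairs in full order with y, and v is
  a root of p^k y but pairs in full order with x. The pairs {x, u} and {y, v} are null because the
  roots were made orthogonal to their own elements.\<close>

lemma exists_block_nonzero:
  assumes e: "0 < e" "e \<le> k"
    and bound: "\<And>x y. x \<in> K \<Longrightarrow> y \<in> K \<Longrightarrow> zmul (p ^ e * p ^ k) (w x y) = 0"
    and xy: "x \<in> K" "y \<in> K" "zmul (p ^ (e - 1) * p ^ k) (w x y) \<noteq> 0"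
  obtains A B where "orthogonal_block K G A B" "\<not> A \<subseteq> {0}"
proof -
  obtain u where u: "u \<in> G" "zmul (p ^ k) x = zmul (p ^ (k - e)) u" "w u x = 0"
      "has_order_pow p k (w u y)"
    using exists_partner[OF e bound xy] by blast
  have "zmul (p ^ (e - 1) * p ^ k) (w y x) \<noteq> 0"
    using xy skew[of x y] in_V by simp
  then obtain v where v: "v \<in> G" "zmul (p ^ k) y = zmul (p ^ (k - e)) v" "w v y = 0"
      "has_order_pow p k (w v x)"
    using exists_partner[OF e bound xy(2,1)] by blast
  have V: "x \<in> V" "y \<in> V" "u \<in> V" "v \<in> V"
    using xy u v in_V by auto
  have rev: "w x u = 0" "w y v = 0" "w u v = 0" "w v u = 0"
    "has_order_pow p k (w y u)" "has_order_pow p k (w x v)"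
    using skew[of x u] skew[of u x] skew[of y v] skew[of v y] skew[of u y] skew[of v x] u v V lagrangianD(5)
    by (auto simp: has_order_pow_minus null_def)
  \<comment> \<open>Second round of the projection. Subtracting multiples of u and v repairs the
    pairings with y and x and leaves those with u and v at 0, as G is isotropic.\<close>
  have fix_x: "\<exists>c d. \<forall>n\<in>{x, u} \<union> {y, v}. w (z - zmul d u - zmul c v) n = 0"
    if z: "z \<in> K" "w z u = 0" "w z v = 0" for z
  proof -
    have zV: "z \<in> V"
      using z in_V by blast
    have "zmul (p ^ k) (w z x) = w z (zmul (p ^ (k - e)) u)"
      using u(2) zV V by (metis zmul_right)
    also have "\<dots> = 0"
      using z zV V by (simp add: form_simps)
    finally obtain c where c: "w z x = zmul c (w v x)"
      using has_order_pow_generates[OF p v(4)] by metis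
    have "zmul (p ^ k) (w z y) = w z (zmul (p ^ (k - e)) v)"
      using v(2) zV V by (metis zmul_right)
    also have "\<dots> = 0"
      using z zV V by (simp add: form_simps)
    finally obtain d where d: "w z y = zmul d (w u y)"
      using has_order_pow_generates[OF p u(4)] by metis
    have "\<forall>n\<in>{x, u} \<union> {y, v}. w (z - zmul d u - zmul c v) n = 0"
      using z zV V u v c d rev by (simp add: form_simps)
    then show ?thesis
      by blast
  qed
  have span: "zmul a x + zmul d u \<in> Z.span {x, u}" "zmul b y + zmul c v \<in> Z.span {y, v}"
    "zmul d u \<in> Z.span {x, u}" "zmul c v \<in> Z.span {y, v}" for a b c d
    by (simp_all add: Z.span_add Z.span_scale Z.span_base)
  have "orthogonal_block K G (Z.span {x, u}) (Z.span {y, v})"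
  proof (rule orthogonal_block_span[OF lagrangianD(1,2,4)])
    show "{x, u} \<subseteq> K" "{y, v} \<subseteq> K"
      using xy u v in_V by auto
    show "null {x, u}" "null {y, v}"
      using u v V rev by (auto simp: null_def alternating)
  next
    fix z assume z: "z \<in> K"
    then have zV: "z \<in> V"
      using in_V by blast
    \<comment> \<open>First round: pairings with u and v are killed by p^k since u and v lie in G,
      so multiples of x and y cancel them.\<close>
    obtain a where a: "w z v = zmul a (w x v)"
      using has_order_pow_generates[OF p rev(6) torsion_form(1)[OF z v(1)]] .
    obtain b where b: "w z u = zmul b (w y u)"
      using has_order_pow_generates[OF p rev(5) torsion_form(1)[OF z u(1)]] .
    have "z - zmul a x - zmul b y \<in> K"
      using z xy lagrangianD(1) by (intro Z.subspace_diff Z.subspace_scale)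
    moreover have "w (z - zmul a x - zmul b y) u = 0" "w (z - zmul a x - zmul b y) v = 0"
      using a b zV V rev by (simp_all add: form_simps)
    ultimately obtain c d where
      "\<forall>n\<in>{x, u} \<union> {y, v}. w (z - zmul a x - zmul b y - zmul d u - zmul c v) n = 0"
      using fix_x by blast
    moreover have "z - zmul a x - zmul b y - zmul d u - zmul c v
        = z - (zmul a x + zmul d u) - (zmul b y + zmul c v)"
      by simp
    ultimately show "\<exists>a\<in>Z.span {x, u}. \<exists>b\<in>Z.span {y, v}. \<forall>n\<in>{x, u} \<union> {y, v}. w (z - a - b) n = 0"
      using span by metis
  next
    fix g assume g: "g \<in> G"
    \<comment> \<open>For elements of G the first round is void, and the corrections d u and c v
      stay in G.\<close>
    then have "w g u = 0" "w g v = 0"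
      using lagrangianD(5) u v by (auto simp: null_def)
    then obtain c d where "\<forall>n\<in>{x, u} \<union> {y, v}. w (g - zmul d u - zmul c v) n = 0"
      using fix_x g in_V by blast
    moreover have "zmul d u \<in> G \<inter> Z.span {x, u}" "zmul c v \<in> G \<inter> Z.span {y, v}"
      using span Z.subspace_scale[OF lagrangianD(3)] u v by auto
    ultimately show "\<exists>a\<in>G \<inter> Z.span {x, u}. \<exists>b\<in>G \<inter> Z.span {y, v}. \<forall>n\<in>{x, u} \<union> {y, v}. w (g - a - b) n = 0"
      by blast
  qed
  moreover have "\<not> Z.span {x, u} \<subseteq> {0}"
  proof
    assume "Z.span {x, u} \<subseteq> {0}"
    then have "x = 0"
      using Z.span_base[of x "{x, u}"] by auto
    then show False
      using xy V by (simp add: zero_left)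
  qed
  ultimately show thesis
    by (rule that)
qed

text \<open>Here all pairings on K are killed by p^k, so a single pairing of order p^k with an
  element of G already allows projection onto the plane spanned by the two elements.\<close>

lemma exists_block_zero:
  assumes "K \<noteq> {0}"
    and zero: "\<And>x y. x \<in> K \<Longrightarrow> y \<in> K \<Longrightarrow> zmul (p ^ k) (w x y) = 0"
  obtains A B where "orthogonal_block K G A B" "\<not> A \<subseteq> {0}"
proof -
  have tors_K: "zmul (p ^ k) x = 0" if "x \<in> K" for x
  proof (rule nondegenerate)
    show "zmul (p ^ k) x \<in> K"
      using lagrangianD(1) that by (rule Z.subspace_scale)
    show "w (zmul (p ^ k) x) y = 0" if "y \<in> K" for y
      using zero[OF \<open>x \<in> K\<close> that] that \<open>x \<in> K\<close> in_V by (simp add: form_simps)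
  qed
  \<comment> \<open>Otherwise p^(k-1) kills G by nondegeneracy. By divisibility, elements of G
    killed by p are p^(k-1)-multiples, hence 0, so G has no p-torsion and vanishes; then K, being
    orthogonal to G, lies in G and vanishes too.\<close>
  have "\<exists>x\<in>K. \<exists>g\<in>G. zmul (p ^ (k - 1)) (w x g) \<noteq> 0"
  proof (rule ccontr)
    assume "\<not> ?thesis"
    then have *: "zmul (p ^ (k - 1)) (w x g) = 0" if "x \<in> K" "g \<in> G" for x g
      using that by blast
    have gz: "zmul (p ^ (k - 1)) g = 0" if "g \<in> G" for g
    proof (rule nondegenerate)
      show "zmul (p ^ (k - 1)) g \<in> K"
        using lagrangianD(1) in_V(3)[OF that] by (rule Z.subspace_scale)
      show "w (zmul (p ^ (k - 1)) g) y = 0" if "y \<in> K" for y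
        using *[OF that \<open>g \<in> G\<close>] skew[of y g] that \<open>g \<in> G\<close> in_V by (simp add: form_simps)
    qed
    have G0: "g = 0" if "g \<in> G" for g
    proof -
      have "zmul (p ^ e) g = 0" if "e \<le> k" for e
        using that
      proof (induction rule: inc_induct)
        case base
        then show ?case
          using torsion[OF \<open>g \<in> G\<close>] .
      next
        case (step n)
        have "zmul (p ^ 1) (zmul (p ^ n) g) = 0"
          using step.IH by simp
        then obtain h where "h \<in> G" "zmul (p ^ n) g = zmul (p ^ (k - 1)) h"
          using divisible[of 1 "zmul (p ^ n) g"] k Z.subspace_scale[OF lagrangianD(3) \<open>g \<in> G\<close>] by auto
        then show ?case
          using gz by simp
      qed
      from this[of 0] show ?thesis
        by simp
    qed
    have "x = 0" if "x \<in> K" for x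
    proof -
      have "x \<in> G"
        using self_perp[OF that] G0 zero_right in_V that by metis
      then show ?thesis
        by (rule G0)
    qed
    then show False
      using assms(1) Z.subspace_0[OF lagrangianD(1)] by blast
  qed
  then obtain x g where xg: "x \<in> K" "g \<in> G" "zmul (p ^ (k - 1)) (w x g) \<noteq> 0"
    by blast
  then have ord: "has_order_pow p k (w x g)"
    using torsion_form k by (simp add: has_order_pow_def)
  have V: "x \<in> V" "g \<in> V"
    using xg in_V by auto
  then have ord': "has_order_pow p k (w g x)"
    using ord skew[of x g] by (simp add: has_order_pow_minus)
  have fix_x: "\<exists>c. \<forall>n\<in>{x} \<union> {g}. w (z - zmul c g) n = 0"
    if z: "z \<in> K" "w z g = 0" for z
  proof -
    obtain c where "w z x = zmul c (w g x)"
      using has_order_pow_generates[OF p ord' zero[OF z(1) xg(1)]] .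
    then have "\<forall>n\<in>{x} \<union> {g}. w (z - zmul c g) n = 0"
      using z V in_V by (simp add: form_simps)
    then show ?thesis ..
  qed
  have span: "zmul a x \<in> Z.span {x}" "zmul a g \<in> Z.span {g}" for a
    by (simp_all add: Z.span_scale Z.span_base)
  have "orthogonal_block K G (Z.span {x}) (Z.span {g})"
  proof (rule orthogonal_block_span[OF lagrangianD(1,2,4)])
    show "{x} \<subseteq> K" "{g} \<subseteq> K"
      using xg in_V by auto
    show "null {x}" "null {g}"
      using V by (auto simp: null_def alternating)
  next
    fix z assume z: "z \<in> K"
    then have zV: "z \<in> V"
      using in_V by blast
    obtain a where a: "w z g = zmul a (w x g)"
      using has_order_pow_generates[OF p ord torsion_form(1)[OF z xg(2)]] .
    have "z - zmul a x \<in> K"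
      using z xg lagrangianD(1) by (intro Z.subspace_diff Z.subspace_scale)
    moreover have "w (z - zmul a x) g = 0"
      using a zV V by (simp add: form_simps)
    ultimately obtain c where "\<forall>n\<in>{x} \<union> {g}. w (z - zmul a x - zmul c g) n = 0"
      using fix_x by blast
    then show "\<exists>a\<in>Z.span {x}. \<exists>b\<in>Z.span {g}. \<forall>n\<in>{x} \<union> {g}. w (z - a - b) n = 0"
      using span by blast
  next
    fix h assume h: "h \<in> G"
    then have "w h g = 0"
      using lagrangianD(5) xg by (auto simp: null_def)
    then obtain c where "\<forall>n\<in>{x} \<union> {g}. w (h - zmul c g) n = 0"
      using fix_x h in_V by blast
    \<comment> \<open>As h is orthogonal to g, its component along x is 0.\<close>
    moreover have "zmul c g \<in> G \<inter> Z.span {g}" "0 \<in> G \<inter> Z.span {x}"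
      using span Z.subspace_scale[OF lagrangianD(3)] Z.subspace_0[OF lagrangianD(3)] xg Z.span_zero by auto
    ultimately show "\<exists>a\<in>G \<inter> Z.span {x}. \<exists>b\<in>G \<inter> Z.span {g}. \<forall>n\<in>{x} \<union> {g}. w (h - a - b) n = 0"
      by (metis diff_zero)
  qed
  moreover have "\<not> Z.span {x} \<subseteq> {0}"
  proof
    assume "Z.span {x} \<subseteq> {0}"
    then have "x = 0"
      using Z.span_base[of x "{x}"] by auto
    then show False
      using xg V by (simp add: zero_left)
  qed
  ultimately show thesis
    by (rule that)
qed

lemma exists_block:
  assumes "K \<noteq> {0}"
  obtains A B where "orthogonal_block K G A B" "\<not> A \<subseteq> {0}"
proof -
  define Q where "Q e \<longleftrightarrow> (\<forall>x\<in>K. \<forall>y\<in>K. zmul (p ^ e * p ^ k) (w x y) = 0)" for e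
  \<comment> \<open>Since p^k x lies in G, its pairings are killed by a further p^k. This gives e
    \<le> k, so that the exponent k - e of the roots makes sense.\<close>
  have "Q k"
    unfolding Q_def
  proof (intro ballI)
    fix x y assume xy: "x \<in> K" "y \<in> K"
    have "zmul (p ^ k * p ^ k) (w x y) = zmul (p ^ k) (w (zmul (p ^ k) x) y)"
      using xy in_V by (simp add: form_simps)
    also have "\<dots> = 0"
      using torsion_form(2)[OF xy(2) zmul_in_G[OF xy(1)]] .
    finally show "zmul (p ^ k * p ^ k) (w x y) = 0" .
  qed
  define e where "e = (LEAST e. Q e)"
  have e: "Q e" "e \<le> k"
    unfolding e_def using \<open>Q k\<close> by (auto intro: LeastI Least_le)
  show thesis
  proof (cases "e = 0")
    case True
    then show thesis
      using exists_block_zero[OF assms] e(1) that by (auto simp: Q_def)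
  next
    case False
    then have "\<not> Q (e - 1)"
      unfolding e_def by (intro not_less_Least) simp
    then obtain x y where xy: "x \<in> K" "y \<in> K" "zmul (p ^ (e - 1) * p ^ k) (w x y) \<noteq> 0"
      by (auto simp: Q_def)
    show thesis
      using exists_block_nonzero[OF _ e(2) _ xy] that False e(1) by (auto simp: Q_def)
  qed
qed

section \<open>Passing to the orthogonal complement of a block\<close>

lemma homogeneous_lagrangian_perp:
  assumes block: "orthogonal_block K G A B"
  defines "K' \<equiv> {x \<in> K. \<forall>n\<in>A \<union> B. w x n = 0}"
  shows "homogeneous_lagrangian p k K' (G \<inter> K')"
proof -
  have AB: "Z.subspace A" "Z.subspace B" "A \<subseteq> K" "B \<subseteq> K" "null A" "null B"
    using block by (auto simp: orthogonal_block_def)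
  have V: "x \<in> V" if "x \<in> A \<or> x \<in> B \<or> x \<in> K'" for x
    using that AB in_V by (auto simp: K'_def)
  have decomp: "\<exists>a\<in>A. \<exists>b\<in>B. \<exists>r\<in>K'. x = a + b + r" if x: "x \<in> K" for x
  proof -
    obtain a b where ab: "a \<in> A" "b \<in> B" "\<forall>n\<in>A \<union> B. w (x - a - b) n = 0"
      using block x unfolding orthogonal_block_def by blast
    have "x - a - b \<in> K"
      using ab AB(3,4) x lagrangianD(1) by (intro Z.subspace_diff) auto
    then have "x - a - b \<in> K'"
      using ab(3) by (simp add: K'_def)
    then show ?thesis
      by (intro bexI[OF _ ab(1)] bexI[OF _ ab(2)] bexI[of _ "x - a - b"]) simp_all
  qed
  \<comment> \<open>This is why blocks must respect G: an element of K' orthogonal to the K'-part of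
    G is then orthogonal to all of G.\<close>
  have decomp_G: "\<exists>a\<in>A. \<exists>b\<in>B. \<exists>r\<in>G \<inter> K'. g = a + b + r" if g: "g \<in> G" for g
  proof -
    obtain a b where ab: "a \<in> G \<inter> A" "b \<in> G \<inter> B" "\<forall>n\<in>A \<union> B. w (g - a - b) n = 0"
      using block g unfolding orthogonal_block_def by blast
    have "g - a - b \<in> G"
      using ab g lagrangianD(3) by (intro Z.subspace_diff) auto
    then have "g - a - b \<in> G \<inter> K'"
      using ab(3) in_V by (simp add: K'_def)
    then show ?thesis
      by (intro bexI[OF _ IntD2[OF ab(1)]] bexI[OF _ IntD2[OF ab(2)]] bexI[of _ "g - a - b"]) simp_all
  qed
  have sub: "Z.subspace K'"
  proof (rule Z.subspaceI)
    show "0 \<in> K'"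
      using Z.subspace_0[OF lagrangianD(1)] zero_left V by (auto simp: K'_def)
    show "x + y \<in> K'" if "x \<in> K'" "y \<in> K'" for x y
      using that Z.subspace_add[OF lagrangianD(1)] add_left in_V V by (auto simp: K'_def)
    show "zmul c x \<in> K'" if "x \<in> K'" for c x
      using that Z.subspace_scale[OF lagrangianD(1)] zmul_left in_V V by (auto simp: K'_def)
  qed
  have nondeg: "x = 0" if x: "x \<in> K'" "\<forall>y\<in>K'. w x y = 0" for x
  proof (rule nondegenerate)
    show "x \<in> K"
      using x by (simp add: K'_def)
    show "w x y = 0" if "y \<in> K" for y
    proof -
      obtain a b r where abr: "a \<in> A" "b \<in> B" "r \<in> K'" "y = a + b + r"
        using decomp \<open>y \<in> K\<close> by blast
      then have "w x a = 0" "w x b = 0" "w x r = 0"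
        using x by (auto simp: K'_def)
      then show ?thesis
        unfolding abr(4) using abr x V by (simp add: form_simps)
    qed
  qed
  have perp: "x \<in> G \<inter> K'" if x: "x \<in> K'" "\<forall>g\<in>G \<inter> K'. w x g = 0" for x
  proof -
    have "x \<in> G"
    proof (rule self_perp)
      show "x \<in> K"
        using x by (simp add: K'_def)
      show "w x g = 0" if "g \<in> G" for g
      proof -
        obtain a b r where abr: "a \<in> A" "b \<in> B" "r \<in> G \<inter> K'" "g = a + b + r"
          using decomp_G \<open>g \<in> G\<close> by blast
        then have "w x a = 0" "w x b = 0" "w x r = 0"
          using x by (auto simp: K'_def)
        then show ?thesis
          unfolding abr(4) using abr x V by (simp add: form_simps)
      qed
    qed
    then show ?thesis
      using x by simp
  qed
  have div: "\<exists>h\<in>G \<inter> K'. g = zmul (p ^ (k - e)) h"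
    if g: "e \<le> k" "g \<in> G \<inter> K'" "zmul (p ^ e) g = 0" for e g
  proof -
    obtain h where h: "h \<in> G" "g = zmul (p ^ (k - e)) h"
      using divisible g by blast
    obtain a b r where abr: "a \<in> A" "b \<in> B" "r \<in> G \<inter> K'" "h = a + b + r"
      using decomp_G h by blast
    \<comment> \<open>The root h may have components in the block; its K'-component r is the root
      wanted. The error u lies in K' and is also a multiple of a + b, hence orthogonal to K', so it
      is 0.\<close>
    define u where "u = g - zmul (p ^ (k - e)) r"
    have u: "u = zmul (p ^ (k - e)) (a + b)"
      by (simp add: u_def h abr Z.scale_right_distrib)
    have "u = 0"
    proof (rule nondeg)
      show "u \<in> K'"
        unfolding u_def using g abr sub by (intro Z.subspace_diff Z.subspace_scale) auto
      show "\<forall>y\<in>K'. w u y = 0"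
      proof
        fix y assume y: "y \<in> K'"
        then have "w y a = 0" "w y b = 0"
          using abr by (auto simp: K'_def)
        then have "w a y = 0" "w b y = 0"
          using skew[of y a] skew[of y b] y abr V by auto
        then show "w u y = 0"
          unfolding u using y abr V by (simp add: form_simps)
      qed
    qed
    then have "g = zmul (p ^ (k - e)) r"
      by (simp add: u_def)
    then show ?thesis
      using abr(3) by blast
  qed
  have "null (G \<inter> K')"
    using lagrangianD(5) by (auto simp: null_def)
  moreover have "Z.subspace (G \<inter> K')" "K' \<subseteq> V" "G \<inter> K' \<subseteq> K'"
    using Z.subspace_inter[OF lagrangianD(3) sub] V by auto
  moreover have "\<forall>g\<in>G \<inter> K'. zmul (p ^ k) g = 0"
    using torsion by simp
  ultimately show ?thesis
    unfolding homogeneous_lagrangian_def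
    using sub nondeg perp div by (intro conjI ballI allI impI) simp_all
qed

lemma splitting_of_block:
  assumes block: "orthogonal_block K G A B"
  defines "K' \<equiv> {x \<in> K. \<forall>n\<in>A \<union> B. w x n = 0}"
  assumes split: "lagrangian_splitting K' (G \<inter> K') A' B'"
  shows "lagrangian_splitting K G {a + a' | a a'. a \<in> A \<and> a' \<in> A'} {b + b' | b b'. b \<in> B \<and> b' \<in> B'}"
proof -
  have AB: "Z.subspace A" "Z.subspace B" "A \<subseteq> K" "B \<subseteq> K" "null A" "null B"
    using block by (auto simp: orthogonal_block_def)
  have AB': "Z.subspace A'" "Z.subspace B'" "A' \<subseteq> K'" "B' \<subseteq> K'" "null A'" "null B'"
    using split by (auto simp: lagrangian_splitting_def)
  have null: "null {c + c' | c c'. c \<in> C \<and> c' \<in> C'}"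
    if C: "null C" "null C'" "C \<subseteq> A \<union> B" "C \<subseteq> K" "C' \<subseteq> K'" for C C'
  proof -
    have "w (c + c') (d + d') = 0" if cd: "c \<in> C" "d \<in> C" "c' \<in> C'" "d' \<in> C'" for c d c' d'
    proof -
      have V: "c \<in> V" "d \<in> V" "c' \<in> V" "d' \<in> V"
        using cd C in_V by (auto simp: K'_def)
      have "c \<in> A \<union> B" "d \<in> A \<union> B" "c' \<in> K'" "d' \<in> K'"
        using cd C by blast+
      then have "w c' d = 0" "w d' c = 0"
        by (auto simp: K'_def)
      moreover have "w c d = 0" "w c' d' = 0"
        using cd C by (auto simp: null_def)
      ultimately show ?thesis
        using V skew[of d' c] by (simp add: form_simps)
    qed
    then show ?thesis
      by (auto simp: null_def)
  qed
  have sub: "{c + c' | c c'. c \<in> C \<and> c' \<in> C'} \<subseteq> K" if "C \<subseteq> K" "C' \<subseteq> K'" for C C'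
    using that lagrangianD(1) by (auto simp: K'_def intro!: Z.subspace_add)
  have "\<exists>a\<in>{a + a' | a a'. a \<in> A \<and> a' \<in> A'}. \<exists>b\<in>{b + b' | b b'. b \<in> B \<and> b' \<in> B'}. x = a + b"
    if x: "x \<in> K" for x
  proof -
    obtain a b where ab: "a \<in> A" "b \<in> B" "\<forall>n\<in>A \<union> B. w (x - a - b) n = 0"
      using block x unfolding orthogonal_block_def by blast
    have "x - a - b \<in> K"
      using ab AB(3,4) x lagrangianD(1) by (intro Z.subspace_diff) auto
    then have "x - a - b \<in> K'"
      using ab(3) by (simp add: K'_def)
    then obtain a' b' where ab': "a' \<in> A'" "b' \<in> B'" "x - a - b = a' + b'"
      using split unfolding lagrangian_splitting_def by blast
    then have "x = (a + a') + (b + b')"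
      by (simp add: algebra_simps)
    then show ?thesis
      using ab ab' by blast
  qed
  moreover have "\<exists>a\<in>G \<inter> {a + a' | a a'. a \<in> A \<and> a' \<in> A'}. \<exists>b\<in>G \<inter> {b + b' | b b'. b \<in> B \<and> b' \<in> B'}. g = a + b"
    if g: "g \<in> G" for g
  proof -
    obtain a b where ab: "a \<in> G \<inter> A" "b \<in> G \<inter> B" "\<forall>n\<in>A \<union> B. w (g - a - b) n = 0"
      using block g unfolding orthogonal_block_def by blast
    have "g - a - b \<in> G"
      using ab g lagrangianD(3) by (intro Z.subspace_diff) auto
    then have "g - a - b \<in> G \<inter> K'"
      using ab(3) in_V by (simp add: K'_def)
    then obtain a' b' where ab': "a' \<in> G \<inter> A'" "b' \<in> G \<inter> B'" "g - a - b = a' + b'"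
      using split unfolding lagrangian_splitting_def by blast
    then have "g = (a + a') + (b + b')"
      by (simp add: algebra_simps)
    moreover have "a + a' \<in> G" "b + b' \<in> G"
      using ab ab' lagrangianD(3) by (auto intro: Z.subspace_add)
    ultimately show ?thesis
      using ab ab' by blast
  qed
  ultimately show ?thesis
    unfolding lagrangian_splitting_def
    using null[of A A'] null[of B B'] sub AB AB' subspace_sums[OF AB(1) AB'(1)]
      subspace_sums[OF AB(2) AB'(2)]
    by (intro conjI ballI) simp_all
qed

end

lemma exists_lagrangian_splitting:
  assumes "Factorial_Ring.prime p" "k > 0" "finite K" "homogeneous_lagrangian p k K G"
  shows "\<exists>A B. lagrangian_splitting K G A B"
  using assms(3,4)
proof (induction "card K" arbitrary: K G rule: less_induct)
  case less
  note hl = assms(1,2) less.prems(2)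
  note D = lagrangianD[OF hl]
  show ?case
  proof (cases "K = {0}")
    case True
    then have "G = {0}"
      using D(4) Z.subspace_0[OF D(3)] by auto
    then have "lagrangian_splitting K G {0} {0}"
      using True V_closed(1) by (simp add: lagrangian_splitting_def null_def alternating)
    then show ?thesis
      by blast
  next
    case False
    obtain A B where AB: "orthogonal_block K G A B" "\<not> A \<subseteq> {0}"
      using exists_block[OF hl False] .
    define K' where "K' = {x \<in> K. \<forall>n\<in>A \<union> B. w x n = 0}"
    obtain n where n: "n \<in> A" "n \<noteq> 0"
      using AB(2) by auto
    have sub: "A \<subseteq> K" "B \<subseteq> K"
      using AB(1) by (auto simp: orthogonal_block_def)
    \<comment> \<open>Strict descent: an element of A orthogonal to the block would be orthogonal to
      the block and to its complement, hence to all of K.\<close>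
    have "n \<notin> K'"
    proof
      assume "n \<in> K'"
      have "n = 0"
      proof (rule nondegenerate[OF hl])
        show "n \<in> K"
          using n sub by auto
        show "w n y = 0" if y: "y \<in> K" for y
        proof -
          obtain a b where ab: "a \<in> A" "b \<in> B" "\<forall>n\<in>A \<union> B. w (y - a - b) n = 0"
            using AB(1) y unfolding orthogonal_block_def by blast
          have V: "n \<in> V" "a \<in> V" "b \<in> V" "y \<in> V"
            using n ab y sub D(2) by auto
          have "w n (y - a - b) = 0"
            using ab(3) n(1) skew[of "y - a - b" n] V V_closed by auto
          moreover have "w n a = 0" "w n b = 0"
            using \<open>n \<in> K'\<close> ab by (auto simp: K'_def)
          ultimately show ?thesis
            using V by (simp add: form_simps)
        qed
      qed
      then show False
        using n by simp
    qed
    then have "K' \<subset> K"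
      using n sub unfolding K'_def by blast
    then have "card K' < card K" "finite K'"
      using less.prems(1) by (auto intro: psubset_card_mono finite_subset)
    then obtain A' B' where "lagrangian_splitting K' (G \<inter> K') A' B'"
      using less.hyps homogeneous_lagrangian_perp[OF hl AB(1)] unfolding K'_def by blast
    then show ?thesis
      using splitting_of_block[OF hl AB(1)] unfolding K'_def by blast
  qed
qed

end

section \<open>Symplectic self-dualities\<close>

locale symplectic_group = comm_group L for L :: "('a, 'b) monoid_scheme" (structure) +
  fixes nabla :: "'a \<Rightarrow> 'a \<Rightarrow> circ"
  assumes finite_L: "finite (carrier L)"
    and self_duality: "symplectic_self_duality L nabla"
begin

lemma nabla_iso: "nabla \<in> iso L (dual L)"
  and nabla_alternating: "x \<in> carrier L \<Longrightarrow> nabla x x = 0"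
  using self_duality by (auto simp: symplectic_self_duality_def)

lemma nabla_dual: "x \<in> carrier L \<Longrightarrow> nabla x \<in> carrier (dual L)"
  using nabla_iso by (auto simp: iso_def hom_def)

lemma nabla_mult_left:
  assumes "x \<in> carrier L" "y \<in> carrier L" "z \<in> carrier L"
  shows "nabla (x \<otimes> y) z = nabla x z + nabla y z"
proof -
  have "nabla (x \<otimes> y) = nabla x \<otimes>\<^bsub>dual L\<^esub> nabla y"
    using nabla_iso assms by (simp add: iso_def hom_def)
  then show ?thesis
    using assms by (simp add: dual_def)
qed

lemma nabla_mult_right:
  assumes "x \<in> carrier L" "y \<in> carrier L" "z \<in> carrier L"
  shows "nabla z (x \<otimes> y) = nabla z x + nabla z y"
  using nabla_dual[OF assms(3)] assms by (simp add: dual_def hom_def circle_group_def)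

lemma nabla_skew:
  assumes "x \<in> carrier L" "y \<in> carrier L"
  shows "nabla y x = - nabla x y"
proof -
  have "nabla (x \<otimes> y) (x \<otimes> y) = nabla x y + nabla y x"
    using assms nabla_alternating[of x] nabla_alternating[of y]
    by (simp add: nabla_mult_left nabla_mult_right)
  moreover have "nabla (x \<otimes> y) (x \<otimes> y) = 0"
    using assms by (intro nabla_alternating m_closed)
  ultimately show ?thesis
    by (simp add: eq_neg_iff_add_eq_0 add.commute)
qed

lemma nabla_one_right: "x \<in> carrier L \<Longrightarrow> nabla x \<one> = 0"
  using nabla_mult_right[of \<one> \<one> x] by simp

lemma nabla_inv_right: "\<lbrakk>x \<in> carrier L; y \<in> carrier L\<rbrakk> \<Longrightarrow> nabla x (inv y) = - nabla x y"
  using nabla_mult_right[of y "inv y" x] nabla_one_right[of x]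
  by (simp add: eq_neg_iff_add_eq_0 add.commute)

lemma nabla_inj:
  assumes "x \<in> carrier L" "y \<in> carrier L" "\<And>z. z \<in> carrier L \<Longrightarrow> nabla x z = nabla y z"
  shows "x = y"
proof -
  have "nabla x \<in> extensional (carrier L)" "nabla y \<in> extensional (carrier L)"
    using nabla_dual assms by (auto simp: dual_def)
  then have "nabla x = nabla y"
    using assms(3) by (rule extensionalityI)
  then show ?thesis
    using nabla_iso assms by (auto simp: iso_def bij_betw_def dest: inj_onD)
qed

lemma nabla_nondegenerate:
  assumes "x \<in> carrier L" "\<And>z. z \<in> carrier L \<Longrightarrow> nabla x z = 0"
  shows "x = \<one>"
proof (rule nabla_inj)
  show "nabla x z = nabla \<one> z" if "z \<in> carrier L" for z
    using assms(2)[OF that] that nabla_skew[of z \<one>] nabla_one_right[of z] by simp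
qed (use assms in auto)

section \<open>Isotropic subgroups of L\<close>

lemma isotropicD:
  assumes "isotropic L nabla N"
  shows "subgroup N L" "N \<subseteq> carrier L" "\<lbrakk>x \<in> N; y \<in> N\<rbrakk> \<Longrightarrow> nabla x y = 0"
  using assms subgroup.subset by (auto simp: isotropic_def)

text \<open>Perpendiculars are subgroups. This is used twice, for H and then for the subgroup it
  generates, with skewness exchanging the arguments in between.\<close>

lemma isotropic_generate:
  assumes H: "H \<subseteq> carrier L" and null: "\<And>x y. \<lbrakk>x \<in> H; y \<in> H\<rbrakk> \<Longrightarrow> nabla x y = 0"
  shows "isotropic L nabla (generate L H)"
proof -
  define perp where "perp S = {u \<in> carrier L. \<forall>s\<in>S. nabla s u = 0}" for S
  have perp: "subgroup (perp S) L" if "S \<subseteq> carrier L" for S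
    using that
    by (intro subgroupI) (auto simp: perp_def nabla_mult_right nabla_inv_right nabla_one_right subset_iff)
  have sub: "generate L H \<subseteq> carrier L"
    using H by (rule generate_incl)
  have "generate L H \<subseteq> perp H"
    using H null perp by (intro generate_subgroup_incl) (auto simp: perp_def)
  then have "nabla u s = 0" if "s \<in> generate L H" "u \<in> H" for s u
    using that by (auto simp: perp_def)
  then have "nabla s u = 0" if "s \<in> generate L H" "u \<in> H" for s u
    using that nabla_skew[of u s] subsetD[OF H that(2)] subsetD[OF sub that(1)] by simp
  then have "H \<subseteq> perp (generate L H)"
    using H by (auto simp: perp_def)
  then have "generate L H \<subseteq> perp (generate L H)"
    using perp[OF sub] by (intro generate_subgroup_incl)
  then show ?thesis
    using generate_is_subgroup[OF H] by (auto simp: isotropic_def perp_def)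
qed

text \<open>Adjoining x to G preserves isotropy, alternation taking care of x against itself;
  maximality then says that nothing was added.\<close>

lemma maximal_isotropic_self_perp:
  assumes max: "maximal_isotropic L nabla G"
    and x: "x \<in> carrier L" "\<And>g. g \<in> G \<Longrightarrow> nabla x g = 0"
  shows "x \<in> G"
proof -
  have iso: "isotropic L nabla G"
    using max by (simp add: maximal_isotropic_def)
  note G = isotropicD[OF iso]
  have "isotropic L nabla (generate L (insert x G))"
  proof (rule isotropic_generate)
    show "nabla u v = 0" if "u \<in> insert x G" "v \<in> insert x G" for u v
      using that x G(2,3) nabla_skew[of x u] nabla_alternating by auto
  qed (use x G in auto)
  moreover have "insert x G \<subseteq> generate L (insert x G)"
    by (auto intro: generate.incl)
  ultimately show ?thesis
    using max by (auto simp: maximal_isotropic_def)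
qed

text \<open>A is a copy of C on natural numbers, and B is the copy of the intersection of G and C.
  The isomorphism is built from L to the product, as the C-component together with the pairing
  against C, and then inverted.\<close>

lemma standard_triple_of_splitting:
  assumes G: "isotropic L nabla G" "\<And>x. \<lbrakk>x \<in> carrier L; \<And>g. g \<in> G \<Longrightarrow> nabla x g = 0\<rbrakk> \<Longrightarrow> x \<in> G"
    and C: "isotropic L nabla C" and D: "isotropic L nabla D"
    and split: "\<And>x. x \<in> carrier L \<Longrightarrow> \<exists>c\<in>C. \<exists>d\<in>D. x = c \<otimes> d"
    and split_G: "\<And>g. g \<in> G \<Longrightarrow> \<exists>c\<in>G \<inter> C. \<exists>d\<in>G \<inter> D. g = c \<otimes> d"
  shows "standard_triple L nabla G"
proof -
  note C' = isotropicD[OF C]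
  note D' = isotropicD[OF D]
  note G' = isotropicD[OF G(1)]
  interpret C: subgroup C L by (rule C')
  interpret D: subgroup D L by (rule D')
  have CD: "x = \<one>" if x: "x \<in> C" "x \<in> D" for x
  proof (rule nabla_nondegenerate)
    show "nabla x z = 0" if z: "z \<in> carrier L" for z
    proof -
      obtain c d where "c \<in> C" "d \<in> D" "z = c \<otimes> d"
        using split z by blast
      then show ?thesis
        using x C' D' by (simp add: nabla_mult_right subset_iff)
    qed
  qed (use x in auto)
  obtain pr where pr: "\<And>x. x \<in> carrier L \<Longrightarrow> pr x \<in> C \<and> (\<exists>d\<in>D. x = pr x \<otimes> d)"
    using split by metis
  have pr_eq: "pr (c \<otimes> d) = c" if cd: "c \<in> C" "d \<in> D" for c d
  proof -
    obtain d' where d': "d' \<in> D" "c \<otimes> d = pr (c \<otimes> d) \<otimes> d'"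
      using pr[of "c \<otimes> d"] cd by auto
    have prC: "pr (c \<otimes> d) \<in> C"
      using pr[of "c \<otimes> d"] cd by auto
    have "inv (pr (c \<otimes> d)) \<otimes> c = d' \<otimes> inv d"
    proof -
      have "inv (pr (c \<otimes> d)) \<otimes> (c \<otimes> d) = d'"
        using prC d' cd by (metis C.mem_carrier D.mem_carrier inv_solve_left m_closed)
      then have "inv (pr (c \<otimes> d)) \<otimes> c \<otimes> d = d'"
        using prC cd by (simp add: m_assoc)
      then show ?thesis
        using prC d' cd by (metis C.m_inv_closed C.mem_carrier D.mem_carrier inv_solve_right m_closed)
    qed
    moreover have "inv (pr (c \<otimes> d)) \<otimes> c \<in> C" "d' \<otimes> inv d \<in> D"
      using prC d' cd by auto
    ultimately have "inv (pr (c \<otimes> d)) \<otimes> c = \<one>"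
      by (intro CD) simp_all
    then show ?thesis
      using prC cd by (metis C.mem_carrier inv_equality inv_inv inv_closed)
  qed
  have pr_mult: "pr (x \<otimes> y) = pr x \<otimes> pr y" if xy: "x \<in> carrier L" "y \<in> carrier L" for x y
  proof -
    obtain d where d: "pr x \<in> C" "d \<in> D" "x = pr x \<otimes> d"
      using pr xy by blast
    obtain e where e: "pr y \<in> C" "e \<in> D" "y = pr y \<otimes> e"
      using pr xy by blast
    have "x \<otimes> y = (pr x \<otimes> pr y) \<otimes> (d \<otimes> e)"
      using d e by (metis C.mem_carrier D.mem_carrier m_ac(1,2,3) m_closed)
    then show ?thesis
      using pr_eq[of "pr x \<otimes> pr y" "d \<otimes> e"] d e by simp
  qed
  have pr_C: "pr c = c" if "c \<in> C" for c
    using pr_eq[OF that D.one_closed] that by simp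
  \<comment> \<open>C and D are isotropic, so only cross terms survive; skewness turns one of them
    into the subtracted term of \<open>nabla0\<close>.\<close>
  have form: "nabla x y = nabla x (pr y) - nabla y (pr x)" if xy: "x \<in> carrier L" "y \<in> carrier L" for x y
  proof -
    obtain d where d: "pr x \<in> C" "d \<in> D" "x = pr x \<otimes> d"
      using pr xy by blast
    obtain e where e: "pr y \<in> C" "e \<in> D" "y = pr y \<otimes> e"
      using pr xy by blast
    have V: "pr x \<in> carrier L" "pr y \<in> carrier L" "d \<in> carrier L" "e \<in> carrier L"
      using d e by auto
    have 0: "nabla d e = 0" "nabla (pr x) (pr y) = 0" "nabla (pr y) (pr x) = 0"
      using C'(3) D'(3) d e by auto
    have "nabla x y = nabla (pr x \<otimes> d) (pr y \<otimes> e)"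
      using d e by simp
    also have "\<dots> = nabla d (pr y) + nabla (pr x) e"
      using V 0 by (simp add: nabla_mult_left nabla_mult_right)
    also have "nabla d (pr y) = nabla (pr x \<otimes> d) (pr y)"
      using V 0 by (simp add: nabla_mult_left)
    also have "nabla (pr x) e = - nabla (pr y \<otimes> e) (pr x)"
      using V 0 nabla_skew[of e "pr x"] by (simp add: nabla_mult_left)
    finally show ?thesis
      using d e by simp
  qed
  obtain f :: "'a \<Rightarrow> nat" where f: "inj_on f C"
    using finite_imp_inj_to_nat_seg[of C] finite_subset[OF C'(2) finite_L] by blast
  define f' where "f' = inv_into C f"
  have f'f: "f' (f c) = c" if "c \<in> C" for c
    using f that by (simp add: f'_def)
  define A where "A = \<lparr>carrier = f ` C, monoid.mult = (\<lambda>m n. f (f' m \<otimes> f' n)), one = f \<one>\<rparr>"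
  have A_simps: "carrier A = f ` C" "\<one>\<^bsub>A\<^esub> = f \<one>" "m \<otimes>\<^bsub>A\<^esub> n = f (f' m \<otimes> f' n)" for m n
    by (simp_all add: A_def)
  have comm_A: "comm_group A"
  proof (rule comm_groupI)
    fix x assume "x \<in> carrier A"
    then obtain c where "c \<in> C" "x = f c"
      by (auto simp: A_simps)
    then show "\<exists>y\<in>carrier A. y \<otimes>\<^bsub>A\<^esub> x = \<one>\<^bsub>A\<^esub>"
      by (intro bexI[of _ "f (inv c)"]) (auto simp: A_simps f'f)
  qed (auto simp: A_simps f'f m_ac)
  define B where "B = f ` (G \<inter> C)"
  have GC: "subgroup (G \<inter> C) L"
    using G'(1) C'(1) by (rule subgroups_Inter_pair)
  have sub_B: "subgroup B A"
  proof (rule group.subgroupI)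
    show "group A"
      using comm_A by (rule comm_group.axioms(2))
    show "B \<subseteq> carrier A" "B \<noteq> {}"
      using subgroup.one_closed[OF GC] by (auto simp: B_def A_simps)
    show "a \<otimes>\<^bsub>A\<^esub> b \<in> B" if "a \<in> B" "b \<in> B" for a b
      using that subgroup.m_closed[OF GC] by (auto simp: B_def A_simps f'f)
    show "inv\<^bsub>A\<^esub> a \<in> B" if a: "a \<in> B" for a
    proof -
      obtain c where c: "c \<in> G \<inter> C" "a = f c"
        using a by (auto simp: B_def)
      have "inv\<^bsub>A\<^esub> a = f (inv c)"
        using c comm_A by (intro group.inv_equality comm_group.axioms(2)) (auto simp: A_simps f'f)
      then show ?thesis
        using c subgroup.m_inv_closed[OF GC] by (auto simp: B_def)
    qed
  qed
  \<comment> \<open>Pairing x with C sees only its D-component, which the isomorphism sends to its character on C.\<close>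
  define psi where "psi x = (f (pr x), \<lambda>n\<in>carrier A. nabla x (f' n))" for x
  have psi_dual: "snd (psi x) \<in> carrier (dual A)" if "x \<in> carrier L" for x
    using that C.m_closed nabla_mult_right
    by (auto simp: psi_def dual_def hom_def circle_group_def A_simps f'f)
  have psi_app: "snd (psi x) (f c) = nabla x c" if "c \<in> C" for x c
    using that by (simp add: psi_def A_simps f'f)
  have psi_hom: "psi \<in> hom L (A \<times>\<times> dual A)"
  proof (rule homI)
    show "psi x \<in> carrier (A \<times>\<times> dual A)" if "x \<in> carrier L" for x
      using psi_dual[OF that] pr[OF that] by (auto simp: psi_def A_simps)
    show "psi (x \<otimes> y) = psi x \<otimes>\<^bsub>A \<times>\<times> dual A\<^esub> psi y" if "x \<in> carrier L" "y \<in> carrier L" for x y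
      using that pr[of x] pr[of y] nabla_mult_left pr_mult
      by (auto simp: psi_def mult_DirProd' dual_def A_simps f'f intro!: restrict_ext)
  qed
  have psi_inj: "inj_on psi (carrier L)"
  proof (rule inj_onI)
    fix x y assume xy: "x \<in> carrier L" "y \<in> carrier L" "psi x = psi y"
    have "pr x = pr y"
      using xy pr[of x] pr[of y] f by (auto simp: psi_def dest: inj_onD)
    have *: "nabla x c = nabla y c" if "c \<in> C" for c
      using psi_app[OF that] xy(3) by metis
    show "x = y"
    proof (rule nabla_inj[OF xy(1,2)])
      fix z assume z: "z \<in> carrier L"
      show "nabla x z = nabla y z"
        using form[OF xy(1) z] form[OF xy(2) z] * pr[OF z] \<open>pr x = pr y\<close> by simp
    qed
  qed
  have psi_surj: "\<exists>x\<in>carrier L. psi x = (f c, chi)" if c: "c \<in> C" and chi: "chi \<in> carrier (dual A)" for c chi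
  proof -
    have chi_mult: "chi (f (a \<otimes> b)) = chi (f a) + chi (f b)" if "a \<in> C" "b \<in> C" for a b
    proof -
      have "chi (f a \<otimes>\<^bsub>A\<^esub> f b) = chi (f a) + chi (f b)"
        using chi that by (simp add: dual_def hom_def circle_group_def A_simps)
      then show ?thesis
        using that by (simp add: A_simps f'f)
    qed
    \<comment> \<open>The character is extended to L by ignoring D and is represented by some y
      through self-duality. The C-component of y is invisible on C and is replaced by c.\<close>
    define xi where "xi = (\<lambda>x\<in>carrier L. chi (f (pr x)))"
    have "xi \<in> carrier (dual L)"
      using pr chi_mult pr_mult by (auto simp: xi_def dual_def hom_def circle_group_def)
    then have "xi \<in> nabla ` carrier L"
      using nabla_iso by (simp add: iso_def bij_betw_def)
    then obtain y where y: "y \<in> carrier L" "nabla y = xi"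
      by blast
    obtain d where d: "d \<in> D" "y = pr y \<otimes> d"
      using pr y by blast
    have yC: "pr y \<in> C"
      using pr y by blast
    have nd: "nabla (c \<otimes> d) a = chi (f a)" if a: "a \<in> C" for a
    proof -
      have "nabla (c \<otimes> d) a = nabla d a"
        using a c d(1) C'(3) by (simp add: nabla_mult_left)
      also have "\<dots> = nabla (pr y \<otimes> d) a"
        using a yC d(1) C'(3) by (simp add: nabla_mult_left)
      also have "\<dots> = chi (f a)"
        using y d(2) a pr_C by (simp add: xi_def)
      finally show ?thesis .
    qed
    have "snd (psi (c \<otimes> d)) = chi"
    proof (rule extensionalityI)
      show "snd (psi (c \<otimes> d)) \<in> extensional (carrier A)" "chi \<in> extensional (carrier A)"
        using chi by (auto simp: psi_def dual_def)
      show "snd (psi (c \<otimes> d)) n = chi n" if "n \<in> carrier A" for n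
        using that psi_app nd by (auto simp: A_simps)
    qed
    then have "psi (c \<otimes> d) = (f c, chi)"
      using pr_eq[OF c d(1)] by (simp add: psi_def)
    then show ?thesis
      using c d by auto
  qed
  have psi_iso: "psi \<in> iso L (A \<times>\<times> dual A)"
  proof (rule isoI[OF psi_hom])
    have "psi ` carrier L = carrier (A \<times>\<times> dual A)"
    proof
      show "psi ` carrier L \<subseteq> carrier (A \<times>\<times> dual A)"
        using psi_hom by (rule hom_carrier)
      show "carrier (A \<times>\<times> dual A) \<subseteq> psi ` carrier L"
      proof
        fix u assume "u \<in> carrier (A \<times>\<times> dual A)"
        then obtain c where "c \<in> C" "fst u = f c" "snd u \<in> carrier (dual A)"
          by (auto simp: A_simps)
        then show "u \<in> psi ` carrier L"
          using psi_surj[of c "snd u"] by (metis image_eqI prod.collapse)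
      qed
    qed
    then show "bij_betw psi (carrier L) (carrier (A \<times>\<times> dual A))"
      using psi_inj by (simp add: bij_betw_def)
  qed
  define phi where "phi = inv_into (carrier L) psi"
  have phi_iso: "phi \<in> iso (A \<times>\<times> dual A) L"
    unfolding phi_def using psi_iso by (rule iso_set_sym)
  have phi_psi: "phi (psi x) = x" if "x \<in> carrier L" for x
    using psi_inj that by (simp add: phi_def)
  have psi_img: "psi ` carrier L = carrier (A \<times>\<times> dual A)"
    using psi_iso by (simp add: iso_def bij_betw_def)
  have "nabla (phi u) (phi v) = nabla0 u v"
    if uv: "u \<in> carrier (A \<times>\<times> dual A)" "v \<in> carrier (A \<times>\<times> dual A)" for u v
  proof -
    obtain x y where xy: "x \<in> carrier L" "y \<in> carrier L" "u = psi x" "v = psi y"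
      using uv unfolding psi_img[symmetric] by blast
    have "nabla0 u v = nabla x (pr y) - nabla y (pr x)"
      using pr[OF xy(1)] pr[OF xy(2)] by (simp add: nabla0_def xy psi_def A_simps f'f)
    then show ?thesis
      using form[OF xy(1,2)] xy phi_psi by simp
  qed
  moreover have "phi ` (B \<times> annihilator A B) = G"
  proof -
    have "psi ` G = B \<times> annihilator A B"
    proof (intro subset_antisym subsetI)
      fix u assume "u \<in> psi ` G"
      then obtain g where g: "g \<in> G" "u = psi g"
        by blast
      then obtain c d where cd: "c \<in> G \<inter> C" "d \<in> G \<inter> D" "g = c \<otimes> d"
        using split_G by blast
      then have "pr g = c"
        using pr_eq by blast
      then have "fst u \<in> B"
        using cd g by (simp add: psi_def B_def)
      moreover have "snd u \<in> annihilator A B"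
        using psi_dual[of g] psi_app[of _ g] g G'(2,3) by (auto simp: annihilator_def B_def)
      ultimately show "u \<in> B \<times> annihilator A B"
        by (simp add: mem_Times_iff)
    next
      fix u assume u: "u \<in> B \<times> annihilator A B"
      then have "u \<in> carrier (A \<times>\<times> dual A)"
        by (auto simp: B_def annihilator_def A_simps)
      then obtain x where x: "x \<in> carrier L" "u = psi x"
        unfolding psi_img[symmetric] by blast
      have "f (pr x) \<in> B"
        using u x by (auto simp: psi_def)
      then have prx: "pr x \<in> G"
        using pr[OF x(1)] f by (auto simp: B_def dest: inj_onD)
      have "x \<in> G"
      \<comment> \<open>Both terms of \<open>form\<close> vanish on G: one because the character of
        x annihilates B, the other because the C-component of x lies in the isotropic G.\<close>
      proof (rule G(2)[OF x(1)])
        fix g assume g: "g \<in> G"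
        then obtain c d where cd: "c \<in> G \<inter> C" "d \<in> G \<inter> D" "g = c \<otimes> d"
          using split_G by blast
        then have prg: "pr g = c"
          using pr_eq by blast
        have "snd u (f c) = 0"
          using u cd by (auto simp: annihilator_def B_def)
        then have "nabla x (pr g) = 0"
          using psi_app[of c x] cd x prg by simp
        moreover have "nabla g (pr x) = 0"
          using G'(3) g prx by simp
        ultimately show "nabla x g = 0"
          using form[of x g] x g G'(2) by auto
      qed
      then show "u \<in> psi ` G"
        using x by blast
    qed
    then have "phi ` (B \<times> annihilator A B) = (phi \<circ> psi) ` G"
      by (metis image_comp)
    also have "\<dots> = (\<lambda>x. x) ` G"
      using phi_psi G'(2) by (intro image_cong) auto
    finally show ?thesis
      by simp
  qed
  moreover have "finite (carrier A)"
    using finite_subset[OF C'(2) finite_L] by (simp add: A_simps)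
  ultimately show ?thesis
    unfolding standard_triple_def using comm_A sub_B phi_iso by blast
qed

text \<open>Through \<open>embed\<close> the group L becomes a subgroup of a type of class \<^class>\<open>ab_group_add\<close>. The
  values outside the carrier are 0 because those of \<open>nabla x\<close> are \<open>undefined\<close> there, which is not
  additive.\<close>

definition embed :: "'a \<Rightarrow> 'a \<Rightarrow> circ" where
  "embed x y = (if y \<in> carrier L then nabla x y else 0)"

text \<open>An embedded element is itself a character of L, extended by 0, so the form is evaluation
  at the element that the second argument represents.\<close>

definition embed_form :: "('a \<Rightarrow> circ) \<Rightarrow> ('a \<Rightarrow> circ) \<Rightarrow> circ" where
  "embed_form u v = u (inv_into (carrier L) embed v)"

lemma embed_mult: "\<lbrakk>x \<in> carrier L; y \<in> carrier L\<rbrakk> \<Longrightarrow> embed (x \<otimes> y) = embed x + embed y"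
  by (auto simp: embed_def fun_eq_iff nabla_mult_left)

lemma embed_inj: "inj_on embed (carrier L)"
proof (rule inj_onI)
  fix x y assume xy: "x \<in> carrier L" "y \<in> carrier L" "embed x = embed y"
  have "nabla x z = nabla y z" if "z \<in> carrier L" for z
    using fun_cong[OF xy(3), of z] that by (simp add: embed_def)
  then show "x = y"
    by (rule nabla_inj[OF xy(1,2)])
qed

lemma embed_form_embed: "\<lbrakk>x \<in> carrier L; y \<in> carrier L\<rbrakk> \<Longrightarrow> embed_form (embed x) (embed y) = nabla x y"
  using embed_inj by (simp add: embed_form_def embed_def[of x])

lemma embed_one: "embed \<one> = 0"
  using embed_mult[of \<one> \<one>] by simp

lemma embed_inv: "x \<in> carrier L \<Longrightarrow> embed (inv x) = - embed x"
  using embed_mult[of "inv x" x] embed_one by (simp add: eq_neg_iff_add_eq_0)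

lemma embed_pow: "x \<in> carrier L \<Longrightarrow> embed (x [^] (n::nat)) = zmul (int n) (embed x)"
  by (induction n) (simp_all add: embed_one embed_mult zmul_add zmul_one add.commute)

lemma subspace_embed:
  assumes "subgroup N L"
  shows "Z.subspace (embed ` N)"
proof -
  interpret subgroup N L by fact
  show ?thesis
  proof (rule subspace_of_add_closed)
    show "0 \<in> embed ` N"
      using embed_one one_closed by force
    show "u + v \<in> embed ` N" if "u \<in> embed ` N" "v \<in> embed ` N" for u v
      using that by (force simp flip: embed_mult)
    show "- u \<in> embed ` N" if "u \<in> embed ` N" for u
      using that by (force simp flip: embed_inv)
  qed
qed

lemma subgroup_embed_vimage:
  assumes "Z.subspace A"
  shows "subgroup {x \<in> carrier L. embed x \<in> A} L"
  using assms
  by (intro subgroupI)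
    (auto simp: embed_mult embed_inv embed_one Z.subspace_add Z.subspace_neg Z.subspace_0
      intro!: exI[of _ \<one>])

lemma alternating_form_embed: "alternating_form (embed ` carrier L) embed_form"
proof
  show "Z.subspace (embed ` carrier L)"
    by (rule subspace_embed[OF subgroup_self])
  show "embed_form (x + y) z = embed_form x z + embed_form y z" for x y z
    by (simp add: embed_form_def)
  show "embed_form x x = 0" if "x \<in> embed ` carrier L" for x
    using that by (auto simp: embed_form_embed nabla_alternating)
  show "embed_form z (x + y) = embed_form z x + embed_form z y"
    if "x \<in> embed ` carrier L" "y \<in> embed ` carrier L" "z \<in> embed ` carrier L" for x y z
    using that by (auto simp: embed_form_embed nabla_mult_right simp flip: embed_mult)
qed

sublocale embedded: alternating_form "embed ` carrier L" embed_form
  by (rule alternating_form_embed)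

section \<open>Transfer between L and its embedded copy\<close>

lemma homogeneous_lagrangian_embed:
  fixes p k :: nat
  assumes G: "maximal_isotropic L nabla G"
    and tors: "\<And>g. g \<in> G \<Longrightarrow> g [^] (p ^ k) = \<one>"
    and div: "\<And>e g. \<lbrakk>e \<le> k; g \<in> G; g [^] (p ^ e) = \<one>\<rbrakk> \<Longrightarrow> \<exists>h\<in>G. g = h [^] (p ^ (k - e))"
  shows "embedded.homogeneous_lagrangian (int p) k (embed ` carrier L) (embed ` G)"
proof -
  note G' = isotropicD[OF conjunct1[OF G[unfolded maximal_isotropic_def]]]
  have pow: "zmul (int p ^ e) (embed g) = embed (g [^] (p ^ e))" if "g \<in> G" for e g
    using embed_pow[of g "p ^ e"] that G'(2) by auto
  have "embedded.null (embed ` G)"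
    using G'(2,3) by (auto simp: embedded.null_def embed_form_embed subset_iff)
  moreover have "\<forall>x\<in>embed ` carrier L. (\<forall>y\<in>embed ` carrier L. embed_form x y = 0) \<longrightarrow> x = 0"
    using nabla_nondegenerate embed_one by (auto simp: embed_form_embed)
  moreover have "\<forall>x\<in>embed ` carrier L. (\<forall>g\<in>embed ` G. embed_form x g = 0) \<longrightarrow> x \<in> embed ` G"
  proof clarify
    fix x assume x: "x \<in> carrier L" "\<forall>g\<in>embed ` G. embed_form (embed x) g = 0"
    have "nabla x g = 0" if "g \<in> G" for g
      using bspec[OF x(2) imageI[OF that]] embed_form_embed[OF x(1) subsetD[OF G'(2) that]] by simp
    then show "embed x \<in> embed ` G"
      using maximal_isotropic_self_perp[OF G x(1)] by blast
  qed
  moreover have "\<forall>g\<in>embed ` G. zmul (int p ^ k) g = 0"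
    using pow tors embed_one by auto
  moreover
  have "\<exists>h\<in>embed ` G. g = zmul (int p ^ (k - e)) h"
    if eg: "e \<le> k" "g \<in> embed ` G" "zmul (int p ^ e) g = 0" for e g
  proof -
    obtain x where x: "x \<in> G" "g = embed x"
      using eg(2) by blast
    have "embed (x [^] (p ^ e)) = embed \<one>"
      using pow[OF x(1)] x eg(3) embed_one by simp
    then have "x [^] (p ^ e) = \<one>"
      using x G'(2) by (intro inj_onD[OF embed_inj]) auto
    then obtain h where h: "h \<in> G" "x = h [^] (p ^ (k - e))"
      using div[OF eg(1) x(1)] by blast
    then have "g = zmul (int p ^ (k - e)) (embed h)"
      using x(2) pow[of h "k - e"] by simp
    then show ?thesis
      using h(1) by blast
  qed
  then have "\<forall>e\<le>k. \<forall>g\<in>embed ` G. zmul (int p ^ e) g = 0 \<longrightarrow> (\<exists>h\<in>embed ` G. g = zmul (int p ^ (k - e)) h)"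
    by (intro allI impI ballI)
  moreover note subspace_embed[OF subgroup_self] subspace_embed[OF G'(1)]
    subset_refl[of "embed ` carrier L"] image_mono[OF G'(2), of embed]
  ultimately show ?thesis
    unfolding embedded.homogeneous_lagrangian_def by (intro conjI)
qed

lemma standard_triple_of_homogeneous:
  fixes p k :: nat
  assumes G: "maximal_isotropic L nabla G"
    and p: "Factorial_Ring.prime p" and k: "k > 0"
    and tors: "\<And>g. g \<in> G \<Longrightarrow> g [^] (p ^ k) = \<one>"
    and div: "\<And>e g. \<lbrakk>e \<le> k; g \<in> G; g [^] (p ^ e) = \<one>\<rbrakk> \<Longrightarrow> \<exists>h\<in>G. g = h [^] (p ^ (k - e))"
  shows "standard_triple L nabla G"
proof -
  have iso: "isotropic L nabla G"
    using G by (simp add: maximal_isotropic_def)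
  have "Factorial_Ring.prime (int p)"
    using p by simp
  moreover have "embedded.homogeneous_lagrangian (int p) k (embed ` carrier L) (embed ` G)"
    using G tors div by (rule homogeneous_lagrangian_embed)
  ultimately have "\<exists>A B. embedded.lagrangian_splitting (embed ` carrier L) (embed ` G) A B"
    using k finite_imageI[OF finite_L] by (intro embedded.exists_lagrangian_splitting)
  then obtain A B where AB: "embedded.lagrangian_splitting (embed ` carrier L) (embed ` G) A B"
    by (elim exE)
  have sub: "Z.subspace A" "Z.subspace B" "A \<subseteq> embed ` carrier L" "B \<subseteq> embed ` carrier L"
    "embedded.null A" "embedded.null B"
    using AB by (auto simp: embedded.lagrangian_splitting_def)
  define C where "C S = {x \<in> carrier L. embed x \<in> S}" for S
  have isoC: "isotropic L nabla (C S)" if "Z.subspace S" "embedded.null S" for S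
    unfolding isotropic_def
  proof (intro conjI ballI)
    show "subgroup (C S) L"
      unfolding C_def using that(1) by (rule subgroup_embed_vimage)
    show "nabla x y = 0" if "x \<in> C S" "y \<in> C S" for x y
      using that \<open>embedded.null S\<close> embed_form_embed[of x y] by (simp add: C_def embedded.null_def)
  qed
  show ?thesis
  proof (rule standard_triple_of_splitting[OF iso maximal_isotropic_self_perp[OF G]
        isoC[OF sub(1,5)] isoC[OF sub(2,6)]])
    fix x assume x: "x \<in> carrier L"
    then obtain a b where ab: "a \<in> A" "b \<in> B" "embed x = a + b"
      using AB unfolding embedded.lagrangian_splitting_def by blast
    then obtain c d where cd: "c \<in> carrier L" "d \<in> carrier L" "a = embed c" "b = embed d"
      using sub by blast
    have "x = c \<otimes> d"
      using x ab cd embed_mult[of c d] by (intro inj_onD[OF embed_inj]) auto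
    then show "\<exists>c\<in>C A. \<exists>d\<in>C B. x = c \<otimes> d"
      using ab cd by (auto simp: C_def)
  next
    fix g assume g: "g \<in> G"
    then obtain a b where ab: "a \<in> embed ` G \<inter> A" "b \<in> embed ` G \<inter> B" "embed g = a + b"
      using AB unfolding embedded.lagrangian_splitting_def by blast
    then obtain c d where cd: "c \<in> G" "d \<in> G" "a = embed c" "b = embed d"
      by blast
    have V: "c \<in> carrier L" "d \<in> carrier L" "g \<in> carrier L"
      using cd g isotropicD(2)[OF iso] by auto
    have "g = c \<otimes> d"
      using V ab cd embed_mult[of c d] by (intro inj_onD[OF embed_inj]) auto
    then show "\<exists>c\<in>G \<inter> C A. \<exists>d\<in>G \<inter> C B. g = c \<otimes> d"
      using ab cd V by (auto simp: C_def)
  qed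
qed

end

section \<open>Homogeneity of powers of Z/p^k\<close>

lemma product_group_pow:
  assumes "x \<in> carrier (product_group I H)"
  shows "x [^]\<^bsub>product_group I H\<^esub> (n::nat) = (\<lambda>i\<in>I. x i [^]\<^bsub>H i\<^esub> n)"
  by (induction n) (auto intro!: restrict_ext)

text \<open>In each coordinate, p^e x_i = 0 modulo p^k means that p^(k-e) divides x_i.\<close>

lemma homogeneous_product:
  fixes p k l :: nat
  defines "P \<equiv> product_group {..<l} (\<lambda>_. integer_mod_group (p ^ k))"
  assumes p: "p > 0" and x: "x \<in> carrier P"
  shows "x [^]\<^bsub>P\<^esub> (p ^ k) = \<one>\<^bsub>P\<^esub>"
    and "\<lbrakk>e \<le> k; x [^]\<^bsub>P\<^esub> (p ^ e) = \<one>\<^bsub>P\<^esub>\<rbrakk> \<Longrightarrow> \<exists>y\<in>carrier P. x = y [^]\<^bsub>P\<^esub> (p ^ (k - e))"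
proof -
  have pow: "y [^]\<^bsub>P\<^esub> n = (\<lambda>i\<in>{..<l}. int n * y i mod int (p ^ k))" if "y \<in> carrier P" for y and n :: nat
    using that unfolding P_def by (subst product_group_pow) simp_all
  have one: "\<one>\<^bsub>P\<^esub> = (\<lambda>i\<in>{..<l}. 0)"
    by (simp add: P_def)
  have carr: "carrier P = {..<l} \<rightarrow>\<^sub>E {0..<int (p ^ k)}"
    using p by (simp add: P_def carrier_integer_mod_group)
  show "x [^]\<^bsub>P\<^esub> (p ^ k) = \<one>\<^bsub>P\<^esub>"
    by (simp add: pow[OF x] one)
  assume e: "e \<le> k" "x [^]\<^bsub>P\<^esub> (p ^ e) = \<one>\<^bsub>P\<^esub>"
  have pk: "int p ^ k = int p ^ e * int p ^ (k - e)"
    using e by (simp flip: power_add)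
  have dvd: "int p ^ (k - e) dvd x i" if "i < l" for i
  proof -
    have "int (p ^ e) * x i mod int (p ^ k) = 0"
      using fun_cong[OF e(2), of i] that by (simp add: pow[OF x] one)
    then have "int p ^ e * int p ^ (k - e) dvd int p ^ e * x i"
      using pk by (simp add: mod_eq_0_iff_dvd)
    then show ?thesis
      using p by simp
  qed
  \<comment> \<open>The quotients are again reduced representatives, and multiplying back gives x_i
    < p^k itself, so the reduction modulo p^k changes nothing.\<close>
  define y where "y = (\<lambda>i\<in>{..<l}. x i div int p ^ (k - e))"
  have xi: "0 \<le> x i \<and> x i < int p ^ k" if "i < l" for i
    using x that by (auto simp: carr PiE_iff)
  have y: "y \<in> carrier P"
  proof -
    have "0 \<le> x i div int p ^ (k - e) \<and> x i div int p ^ (k - e) < int p ^ k" if "i < l" for i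
    proof -
      have "x i div int p ^ (k - e) \<le> x i"
        using zdiv_mono2[of "x i" 1 "int p ^ (k - e)"] xi[OF that] p by simp
      then show ?thesis
        using xi[OF that] p by (simp add: pos_imp_zdiv_nonneg_iff)
    qed
    then show ?thesis
      by (auto simp: carr y_def)
  qed
  have "x = y [^]\<^bsub>P\<^esub> (p ^ (k - e))"
  proof
    fix i
    show "x i = (y [^]\<^bsub>P\<^esub> (p ^ (k - e))) i"
    proof (cases "i < l")
      case True
      then have "y i = x i div int p ^ (k - e)"
        by (simp add: y_def)
      then show ?thesis
        using dvd[OF True] xi[OF True] True by (simp add: pow[OF y])
    next
      case False
      then show ?thesis
        using x by (auto simp: pow[OF y] carr PiE_iff extensional_def)
    qed
  qed
  then show "\<exists>y\<in>carrier P. x = y [^]\<^bsub>P\<^esub> (p ^ (k - e))"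
    using y by blast
qed

theorem theorem10p8:
  fixes L :: "('a, 'b) monoid_scheme" and nabla :: "'a \<Rightarrow> 'a \<Rightarrow> circ"
    and G :: "'a set" and p k l :: nat
  assumes "comm_group L" and "finite (carrier L)"
    and "symplectic_self_duality L nabla"
    and "maximal_isotropic L nabla G"
    and "Factorial_Ring.prime p" and "odd p" and "k > 0" and "l > 0"
    and "L\<lparr>carrier := G\<rparr> \<cong> product_group {..<l} (\<lambda>_. integer_mod_group (p ^ k))"
  shows "standard_triple L nabla G"
proof -
  interpret symplectic_group L nabla
    using assms(1-3) by (simp add: symplectic_group_def symplectic_group_axioms_def)
  let ?P = "product_group {..<l} (\<lambda>_. integer_mod_group (p ^ k))"
  let ?G = "L\<lparr>carrier := G\<rparr>"
  have "subgroup G L"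
    using assms(4) by (simp add: maximal_isotropic_def isotropic_def)
  then have grp: "group ?G"
    by (rule subgroup_imp_group)
  have P: "group ?P"
    by simp
  obtain f where f: "f \<in> iso ?G ?P"
    using assms(9) by (auto simp: is_iso_def)
  have inj: "inj_on f G" and img: "f ` G = carrier ?P" and hom: "f \<in> hom ?G ?P"
    using f by (auto simp: iso_def bij_betw_def)
  have pow: "f (g [^]\<^bsub>L\<^esub> n) = f g [^]\<^bsub>?P\<^esub> n" and pow_G: "g [^]\<^bsub>L\<^esub> n \<in> G" if "g \<in> G" for g and n :: nat
    using hom_nat_pow[OF hom _ grp P, of g n] monoid.nat_pow_closed[OF group.is_monoid[OF grp], of g n] that
    by (simp_all flip: nat_pow_consistent)
  have one: "f \<one>\<^bsub>L\<^esub> = \<one>\<^bsub>?P\<^esub>" and one_G: "\<one>\<^bsub>L\<^esub> \<in> G"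
    using hom_one[OF hom grp P] monoid.one_closed[OF group.is_monoid[OF grp]] by simp_all
  have p: "p > 0"
    using assms(5) by (rule prime_gt_0_nat)
  have fP: "f g \<in> carrier ?P" if "g \<in> G" for g
    using img that by blast
  show ?thesis
  proof (rule standard_triple_of_homogeneous[OF assms(4,5,7)])
    fix g assume g: "g \<in> G"
    show "g [^]\<^bsub>L\<^esub> (p ^ k) = \<one>\<^bsub>L\<^esub>"
      using homogeneous_product(1)[OF p fP[OF g]] pow pow_G one one_G g
      by (intro inj_onD[OF inj]) simp_all
    show "\<exists>h\<in>G. g = h [^]\<^bsub>L\<^esub> (p ^ (k - e))" if e: "e \<le> k" "g [^]\<^bsub>L\<^esub> (p ^ e) = \<one>\<^bsub>L\<^esub>" for e
    proof -
      have "f g [^]\<^bsub>?P\<^esub> (p ^ e) = \<one>\<^bsub>?P\<^esub>"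
        using pow[OF g] e(2) one by metis
      then obtain y where y: "y \<in> carrier ?P" "f g = y [^]\<^bsub>?P\<^esub> (p ^ (k - e))"
        using homogeneous_product(2)[OF p fP[OF g] e(1)] by blast
      then obtain h where h: "h \<in> G" "y = f h"
        using img by blast
      then have "g = h [^]\<^bsub>L\<^esub> (p ^ (k - e))"
        using y g pow pow_G by (intro inj_onD[OF inj]) simp_all
      then show ?thesis
        using h by blast
    qed
  qed
qed

end
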